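(* Let $\Omega=\mathbf{R}^d\setminus\{0\}$, so $d_\Omega(x)=|x|$, let $\delta,\delta'\geq0$, $c(s)=s^\delta(1+s)^{\delta'-\delta}$ for $s>0$, $c_\Omega(x)=c(|x|)$, and let $h$ be the corresponding Dirichlet form on $L_2(\Omega)$ defined in the context. If $d+(\delta\wedge\delta')-2>0$ then the Hardy inequality $$h(\varphi)\geq a_1\,(c_\Omega^{1/2}d_\Omega^{-1}\varphi,\,c_\Omega^{1/2}d_\Omega^{-1}\varphi)$$ is valid for all $\varphi\in D(h)$ with $a_1=(d+(\delta\wedge\delta')-2)^2/4$. The value of $a_1$ is optimal.
   Context: $L_2(\Omega)$ is the real $L_2$-space with respect to Lebesgue measure, with inner product $(\cdot,\cdot)$. The form $h$ is the closure of $\varphi\in C_c^\infty(\Omega)\mapsto h(\varphi)=\sum_{k=1}^d(\partial_k\varphi,c_\Omega\,\partial_k\varphi)$, a Dirichlet form with domain $D(h)$. $\wedge$ denotes minimum. "Optimal" means that $a_1$ is the largest constant for which the inequality holds for all $\varphi\in D(h)$. *)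

theory Defs
  imports "HOL-Analysis.Analysis"
begin

text \<open>Elements of real \<open>L\<^sub>2\<close> are handled through representatives: square-integrable
  measurable functions, with no passage to the quotient modulo null sets. Functions on
  a subset \<open>\<Omega>\<close> are total functions whose values outside \<open>\<Omega>\<close> are immaterial.\<close>

definition L2_space :: "'a measure \<Rightarrow> ('a \<Rightarrow> real) set" where
  "L2_space M = {f \<in> borel_measurable M. integrable M (\<lambda>x. (f x)\<^sup>2)}"

definition L2_inner :: "'a measure \<Rightarrow> ('a \<Rightarrow> real) \<Rightarrow> ('a \<Rightarrow> real) \<Rightarrow> real" where
  "L2_inner M f g = (\<integral>x. f x * g x \<partial>M)"

definition partial_deriv :: "'n::finite \<Rightarrow> (real^'n \<Rightarrow> real) \<Rightarrow> real^'n \<Rightarrow> real" where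
  "partial_deriv k f x = frechet_derivative f (at x) (axis k 1)"

fun C_k :: "nat \<Rightarrow> (real^'n::finite \<Rightarrow> real) \<Rightarrow> bool" where
  "C_k 0 f \<longleftrightarrow> continuous_on UNIV f"
| "C_k (Suc m) f \<longleftrightarrow> f differentiable_on UNIV \<and> (\<forall>k. C_k m (partial_deriv k f))"

text \<open>Test functions on an open set \<open>\<Omega>\<close>, identified with their extensions by zero.\<close>

definition test_functions :: "(real^'n::finite) set \<Rightarrow> (real^'n \<Rightarrow> real) set" where
  "test_functions \<Omega> = {f. (\<forall>m. C_k m f) \<and>
     compact (closure {x. f x \<noteq> 0}) \<and> closure {x. f x \<noteq> 0} \<subseteq> \<Omega>}"

definition pre_form ::
  "(real^'n::finite) set \<Rightarrow> (real^'n \<Rightarrow> real) \<Rightarrow> (real^'n \<Rightarrow> real) \<Rightarrow> real" where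
  "pre_form \<Omega> c f = (\<Sum>k\<in>UNIV. L2_inner (lebesgue_on \<Omega>)
     (partial_deriv k f) (\<lambda>x. c x * partial_deriv k f x))"

text \<open>Closure of a quadratic form \<open>q\<close> with domain \<open>D\<close> in \<open>L\<^sub>2(M)\<close>: \<open>f\<close> belongs to the
  domain of the closure if it is the \<open>L\<^sub>2\<close>-limit of a \<open>q\<close>-Cauchy sequence in \<open>D\<close>, and the
  value at \<open>f\<close> is the common limit of \<open>q\<close> along all such sequences. This common limit
  exists for every \<open>f\<close> in the domain precisely when \<open>q\<close> is closable; otherwise the
  description operator leaves the value unspecified.\<close>

definition form_approx ::
  "'a measure \<Rightarrow> ('a \<Rightarrow> real) set \<Rightarrow> (('a \<Rightarrow> real) \<Rightarrow> real) \<Rightarrow> (nat \<Rightarrow> 'a \<Rightarrow> real) \<Rightarrow> ('a \<Rightarrow> real) \<Rightarrow> bool" where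
  "form_approx M D q u f \<longleftrightarrow> (\<forall>n. u n \<in> D) \<and>
     (\<lambda>n. L2_inner M (\<lambda>x. u n x - f x) (\<lambda>x. u n x - f x)) \<longlonglongrightarrow> 0 \<and>
     (\<forall>e>0. \<exists>N. \<forall>m\<ge>N. \<forall>n\<ge>N. q (\<lambda>x. u m x - u n x) < e)"

definition closure_dom ::
  "'a measure \<Rightarrow> ('a \<Rightarrow> real) set \<Rightarrow> (('a \<Rightarrow> real) \<Rightarrow> real) \<Rightarrow> ('a \<Rightarrow> real) set" where
  "closure_dom M D q = {f \<in> L2_space M. \<exists>u. form_approx M D q u f}"

definition closure_form ::
  "'a measure \<Rightarrow> ('a \<Rightarrow> real) set \<Rightarrow> (('a \<Rightarrow> real) \<Rightarrow> real) \<Rightarrow> ('a \<Rightarrow> real) \<Rightarrow> real" where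
  "closure_form M D q f = (THE v. \<forall>u. form_approx M D q u f \<longrightarrow> (\<lambda>n. q (u n)) \<longlonglongrightarrow> v)"

definition h_dom :: "(real^'n::finite) set \<Rightarrow> (real^'n \<Rightarrow> real) \<Rightarrow> (real^'n \<Rightarrow> real) set" where
  "h_dom \<Omega> c = closure_dom (lebesgue_on \<Omega>) (test_functions \<Omega>) (pre_form \<Omega> c)"

definition h_form ::
  "(real^'n::finite) set \<Rightarrow> (real^'n \<Rightarrow> real) \<Rightarrow> (real^'n \<Rightarrow> real) \<Rightarrow> real" where
  "h_form \<Omega> c = closure_form (lebesgue_on \<Omega>) (test_functions \<Omega>) (pre_form \<Omega> c)"

definition bdry_dist :: "(real^'n::finite) set \<Rightarrow> real^'n \<Rightarrow> real" where
  "bdry_dist \<Omega> x = infdist x (frontier \<Omega>)"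

text \<open>The membership in \<open>L\<^sub>2\<close> is part of the inequality, because the Bochner integral of
  a non-integrable function is \<open>0\<close>.\<close>

definition hardy_inequality ::
  "(real^'n::finite) set \<Rightarrow> (real^'n \<Rightarrow> real) \<Rightarrow> real \<Rightarrow> bool" where
  "hardy_inequality \<Omega> c a \<longleftrightarrow> (\<forall>f \<in> h_dom \<Omega> c.
     let g = (\<lambda>x. sqrt (c x) * inverse (bdry_dist \<Omega> x) * f x)
     in g \<in> L2_space (lebesgue_on \<Omega>) \<and> h_form \<Omega> c f \<ge> a * L2_inner (lebesgue_on \<Omega>) g g)"

definition degeneracy_coeff :: "real \<Rightarrow> real \<Rightarrow> real \<Rightarrow> real" where
  "degeneracy_coeff \<delta> \<delta>' s = s powr \<delta> * (1 + s) powr (\<delta>' - \<delta>)"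

lemma bdry_dist_punctured: "bdry_dist (UNIV - {0}) (x :: real^'n::finite) = norm x"
proof -
  have "frontier (UNIV - {0 :: real^'n}) = {0}"
    using frontier_complement[of "{0 :: real^'n}"]
    by (simp add: Compl_eq_Diff_UNIV frontier_def)
  then show ?thesis
    by (simp add: bdry_dist_def)
qed

end

theory Submission
  imports Defs
begin

text \<open>Let \<open>D = d + (\<delta> \<and> \<delta>') - 2\<close> and \<open>W = c |x|\<^sup>-\<^sup>2\<close>. Since \<open>s c'(s)/c(s)\<close> lies between \<open>\<delta>\<close> and
  \<open>\<delta>'\<close>, the field \<open>W x\<close> has divergence at least \<open>D W\<close>; expanding
  \<open>\<integral> c |grad u + (D/2) u x/|x|\<^sup>2|\<^sup>2 \<ge> 0\<close> and integrating the cross term by parts gives the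
  inequality on test functions, and Fatou's lemma extends it to the closure. For optimality
  insert \<open>u = |x|\<^sup>-\<^sup>D\<^sup>/\<^sup>2 \<eta>(\<epsilon> ln |x| + s)\<close> with a fixed smooth bump \<open>\<eta>\<close>, supported near \<open>0\<close> or
  near \<open>\<infinity>\<close> according to which exponent is smaller. There \<open>W |x|\<^sup>-\<^sup>D\<close> is comparable to
  \<open>|x|\<^sup>-\<^sup>d\<close>, whose integrals over annuli are scale invariant, so the error terms are
  smaller than the main term by a factor of order \<open>\<epsilon>\<close>.\<close>

section \<open>Functions of class C^k on open subsets of Euclidean space\<close>

text \<open>Since \<open>h_form\<close> is a definite description, nothing can be said about its
  values before closability is established. That argument moves a derivative onto \<open>c\<close>
  times a derivative of a test function, which is why the coefficient is taken of class C^1.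
  Coefficient and weight are regular only off the origin, so every integration by parts concerns a
  product with a factor of compact support in the punctured space; such a product extends by zero to
  a C^1 function on the whole space. The power of \<open>|x|\<close> in the trial functions is the
  radial function for which the square in the overview vanishes identically. Its weighted square
  integral diverges only logarithmically at the relevant end, so the natural variable for cutting it
  off is \<open>ln |x|\<close>: the bump then has length of order \<open>1/\<epsilon>\<close>, the
  main term is of that order, and the error stays bounded. No surface measure is computed: the
  support is the union of three annuli that are dilates of one another, so its mass is at most three
  times the mass of the middle one, on which the bump is bounded below.\<close>

lemma partial_deriv_eq:
  "(f has_derivative f') (at x) \<Longrightarrow> partial_deriv k f x = f' (axis k 1)"
  unfolding partial_deriv_def using frechet_derivative_at by metis

lemma partial_deriv_cong_open:
  assumes "open S" "x \<in> S" "\<And>y. y \<in> S \<Longrightarrow> f y = g y"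
  shows "partial_deriv k f x = partial_deriv k g x"
proof -
  have "(f has_derivative f') (at x) \<longleftrightarrow> (g has_derivative f') (at x)" for f'
    using assms has_derivative_transform_within_open[of f f' x UNIV S g]
      has_derivative_transform_within_open[of g f' x UNIV S f] by auto
  then show ?thesis unfolding partial_deriv_def frechet_derivative_def by simp
qed

lemma partial_deriv_const: "partial_deriv k (\<lambda>x. a) x = 0"
  by (subst partial_deriv_eq) (auto intro!: derivative_eq_intros)

lemma partial_deriv_nth: "partial_deriv k (\<lambda>x. x $ i) x = (if i = k then 1 else 0)"
  by (subst partial_deriv_eq[where f' = "\<lambda>h. h $ i"])
    (auto intro!: bounded_linear_imp_has_derivative bounded_linear_vec_nth simp: axis_def)

lemma partial_deriv_add:
  assumes "f differentiable at x" "g differentiable at x"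
  shows "partial_deriv k (\<lambda>x. f x + g x) x = partial_deriv k f x + partial_deriv k g x"
  unfolding partial_deriv_def using assms
  by (subst frechet_derivative_at[symmetric, OF has_derivative_add])
    (auto simp: frechet_derivative_works)

lemma partial_deriv_diff:
  assumes "f differentiable at x" "g differentiable at x"
  shows "partial_deriv k (\<lambda>x. f x - g x) x = partial_deriv k f x - partial_deriv k g x"
  unfolding partial_deriv_def using assms
  by (subst frechet_derivative_at[symmetric, OF has_derivative_diff])
    (auto simp: frechet_derivative_works)

lemma partial_deriv_mult:
  assumes "f differentiable at x" "g differentiable at x"
  shows "partial_deriv k (\<lambda>x. f x * g x) x = partial_deriv k f x * g x + f x * partial_deriv k g x"
  unfolding partial_deriv_def using assms
  by (subst frechet_derivative_at[symmetric, OF has_derivative_mult])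
    (auto simp: frechet_derivative_works)

lemma chain_real_at:
  fixes u :: "real^'n::finite \<Rightarrow> real"
  assumes "(g has_real_derivative d) (at (u x))" "u differentiable at x"
  shows differentiable_chain_real: "(\<lambda>x. g (u x)) differentiable at x"
    and partial_deriv_chain: "partial_deriv k (\<lambda>x. g (u x)) x = d * partial_deriv k u x"
proof -
  have "((\<lambda>x. g (u x)) has_derivative (\<lambda>h. d * frechet_derivative u (at x) h)) (at x)"
    using assms has_derivative_compose[of u "frechet_derivative u (at x)" x UNIV g "(*) d"]
    by (auto simp: has_field_derivative_def frechet_derivative_works)
  then show "(\<lambda>x. g (u x)) differentiable at x"
    "partial_deriv k (\<lambda>x. g (u x)) x = d * partial_deriv k u x"
    using partial_deriv_eq unfolding differentiable_def partial_deriv_def[of k u] by blast+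
qed

text \<open>Local version of \<open>C_k\<close>, needed because \<open>c\<close> and
  \<open>ln (norm x)\<close> are regular only off the origin. Differentiability is required at
  points rather than within \<open>S\<close>, so that on an open \<open>S\<close> the global
  \<open>partial_deriv\<close> is the right derivative to iterate.\<close>

fun Ck_on :: "nat \<Rightarrow> (real^'n::finite) set \<Rightarrow> (real^'n \<Rightarrow> real) \<Rightarrow> bool" where
  "Ck_on 0 S f \<longleftrightarrow> continuous_on S f"
| "Ck_on (Suc m) S f \<longleftrightarrow> (\<forall>x\<in>S. f differentiable at x) \<and> (\<forall>k. Ck_on m S (partial_deriv k f))"

lemma C_k_iff_Ck_on: "C_k m f \<longleftrightarrow> Ck_on m UNIV f"
  by (induction m arbitrary: f) (auto simp: differentiable_on_def)

lemma Ck_on_cong: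
  assumes "open S" "\<And>x. x \<in> S \<Longrightarrow> f x = g x" "Ck_on m S f"
  shows "Ck_on m S g"
  using assms(2,3)
proof (induction m arbitrary: f g)
  case 0
  then show ?case using continuous_on_cong by (metis Ck_on.simps(1))
next
  case (Suc m)
  have "g differentiable at x" if x: "x \<in> S" for x
  proof -
    obtain f' where "(f has_derivative f') (at x)"
      using x Suc.prems(2) unfolding Ck_on.simps differentiable_def by blast
    then have "(g has_derivative f') (at x)"
      by (rule has_derivative_transform_within_open) (use x Suc.prems \<open>open S\<close> in auto)
    then show ?thesis by (rule differentiableI)
  qed
  moreover have "Ck_on m S (partial_deriv k g)" for k
    using Suc.IH[of "partial_deriv k f" "partial_deriv k g"] Suc.prems
      partial_deriv_cong_open[OF \<open>open S\<close>, of _ f g] by auto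
  ultimately show ?case by simp
qed

lemma Ck_on_SucD: "Ck_on (Suc m) S f \<Longrightarrow> Ck_on m S f"
proof (induction m arbitrary: f)
  case 0
  then show ?case
    by (auto intro!: continuous_at_imp_continuous_on differentiable_imp_continuous_within)
next
  case (Suc m)
  then show ?case by simp
qed

lemma Ck_on_le: "m \<le> n \<Longrightarrow> Ck_on n S f \<Longrightarrow> Ck_on m S f"
  by (induction n) (auto simp: le_Suc_eq dest: Ck_on_SucD simp del: Ck_on.simps)

lemma Ck_on_subset: "Ck_on m S f \<Longrightarrow> T \<subseteq> S \<Longrightarrow> Ck_on m T f"
  by (induction m arbitrary: f) (auto intro: continuous_on_subset)

text \<open>Regularity is local on open sets; this glues a function near its support to the zero
  function elsewhere.\<close>

lemma Ck_on_Un: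
  assumes "open S" "open T"
  shows "Ck_on m S f \<Longrightarrow> Ck_on m T f \<Longrightarrow> Ck_on m (S \<union> T) f"
  using assms by (induction m arbitrary: f) (auto intro: continuous_on_open_Un)

lemma Ck_on_const: "Ck_on m S (\<lambda>x. a)"
proof (induction m arbitrary: a)
  case (Suc m)
  have "partial_deriv k (\<lambda>x::real^'a. a) = (\<lambda>x. 0)" for k
    using partial_deriv_const by blast
  then show ?case using Suc by simp
qed simp

lemma Ck_on_nth: "Ck_on m S (\<lambda>x. x $ i)"
proof (cases m)
  case (Suc m')
  have "partial_deriv k (\<lambda>x::real^'a. x $ i) = (\<lambda>x. if i = k then 1 else 0)" for k
    using partial_deriv_nth by blast
  moreover have "(\<lambda>x::real^'a. x $ i) differentiable at x" for x
    by (intro bounded_linear_imp_differentiable bounded_linear_vec_nth)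
  ultimately show ?thesis
    using Suc Ck_on_const[of m' S 0] Ck_on_const[of m' S 1] by simp
qed (simp add: continuous_intros)

lemma Ck_on_add:
  assumes "open S" shows "Ck_on m S f \<Longrightarrow> Ck_on m S g \<Longrightarrow> Ck_on m S (\<lambda>x. f x + g x)"
proof (induction m arbitrary: f g)
  case (Suc m)
  have "Ck_on m S (partial_deriv k (\<lambda>x. f x + g x))" for k
    by (rule Ck_on_cong[OF \<open>open S\<close> _ Suc.IH[of "partial_deriv k f" "partial_deriv k g"]])
      (use Suc.prems in \<open>auto simp: partial_deriv_add\<close>)
  then show ?case using Suc.prems by simp
qed (simp add: continuous_intros)

lemma Ck_on_mult:
  assumes "open S" shows "Ck_on m S f \<Longrightarrow> Ck_on m S g \<Longrightarrow> Ck_on m S (\<lambda>x. f x * g x)"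
proof (induction m arbitrary: f g)
  case (Suc m)
  have "Ck_on m S (partial_deriv k (\<lambda>x. f x * g x))" for k
    by (rule Ck_on_cong[OF \<open>open S\<close> _ Ck_on_add[OF \<open>open S\<close> Suc.IH[of "partial_deriv k f" g]
          Suc.IH[of f "partial_deriv k g"]]])
      (use Suc.prems Ck_on_SucD[OF Suc.prems(1)] Ck_on_SucD[OF Suc.prems(2)] in
        \<open>auto simp: partial_deriv_mult\<close>)
  then show ?case using Suc.prems by simp
qed (simp add: continuous_intros)

lemma Ck_on_diff:
  assumes "open S" "Ck_on m S f" "Ck_on m S g" shows "Ck_on m S (\<lambda>x. f x - g x)"
  using Ck_on_add[OF assms(1,2) Ck_on_mult[OF assms(1) Ck_on_const[of _ _ "-1"] assms(3)]] by simp

lemma Ck_on_sum: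
  assumes "open S" "\<And>i. i \<in> I \<Longrightarrow> Ck_on m S (f i)" shows "Ck_on m S (\<lambda>x. \<Sum>i\<in>I. f i x)"
  using assms(2)
  by (induction I rule: infinite_finite_induct) (auto intro: Ck_on_add[OF assms(1)] Ck_on_const)

section \<open>Composition with the exponential, the logarithm and a flat function\<close>

lemma Ck_on_exp:
  assumes "open S" shows "Ck_on m S u \<Longrightarrow> Ck_on m S (\<lambda>x. exp (u x))"
proof (induction m)
  case (Suc m)
  have "Ck_on m S (partial_deriv k (\<lambda>x. exp (u x)))" for k
    by (rule Ck_on_cong[OF \<open>open S\<close> _ Ck_on_mult[OF \<open>open S\<close> Suc.IH, of "partial_deriv k u"]])
      (use Suc.prems Ck_on_SucD[OF Suc.prems] in \<open>auto simp: partial_deriv_chain[OF DERIV_exp]\<close>)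
  then show ?case using Suc.prems by (auto intro: differentiable_chain_real[OF DERIV_exp])
qed (simp add: continuous_intros)

text \<open>The derivative of \<open>ln u\<close> contains \<open>1 / u\<close>. Writing this factor
  as \<open>exp (- ln u)\<close> lets the induction hypothesis for \<open>ln u\<close> itself supply
  its regularity.\<close>

lemma Ck_on_ln:
  assumes "open S" "\<And>x. x \<in> S \<Longrightarrow> u x > 0"
  shows "Ck_on m S u \<Longrightarrow> Ck_on m S (\<lambda>x. ln (u x))"
proof (induction m)
  case 0
  have "\<forall>x\<in>S. u x \<noteq> 0" using assms(2) by force
  with 0 show ?case unfolding Ck_on.simps by (intro continuous_on_ln) auto
next
  case (Suc m)
  have IH: "Ck_on m S (\<lambda>x. exp (- 1 * ln (u x)))"
    by (rule Ck_on_exp[OF assms(1) Ck_on_mult[OF assms(1) Ck_on_const Suc.IH[OF Ck_on_SucD[OF Suc.prems]]]])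
  have "Ck_on m S (partial_deriv k (\<lambda>x. ln (u x)))" for k
    by (rule Ck_on_cong[OF \<open>open S\<close> _ Ck_on_mult[OF \<open>open S\<close> IH, of "partial_deriv k u"]])
      (use Suc.prems assms(2) in
        \<open>auto simp: partial_deriv_chain[OF DERIV_ln] exp_minus\<close>)
  then show ?case using Suc.prems assms(2) by (auto intro: differentiable_chain_real[OF DERIV_ln])
qed

text \<open>Index \<open>0\<close> is the classical function \<open>exp (- 1 / t)\<close>, extended
  by zero to \<open>t \<le> 0\<close>. Dividing by \<open>t ^ j\<close> gives a family whose linear
  span is closed under differentiation, so smoothness becomes an induction over all \<open>j\<close>
  at once.\<close>

definition flat_exp :: "nat \<Rightarrow> real \<Rightarrow> real" where
  "flat_exp j t = (if t > 0 then exp (- (1 / t)) / t ^ j else 0)"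

lemma flat_exp_tendsto_0: "(flat_exp j \<longlongrightarrow> 0) (at 0)"
proof -
  have "((\<lambda>t. t ^ j / exp t) \<longlongrightarrow> (0::real)) at_top"
    by (rule tendsto_power_div_exp_0)
  then have "((\<lambda>t. inverse t ^ j / exp (inverse t)) \<longlongrightarrow> (0::real)) (at_right 0)"
    by (rule filterlim_compose) (rule filterlim_inverse_at_top_right)
  moreover have "\<forall>\<^sub>F t in at_right 0. inverse t ^ j / exp (inverse t) = flat_exp j t"
    unfolding eventually_at_right_field
    by (auto intro!: exI[of _ 1] simp: flat_exp_def exp_minus inverse_eq_divide power_divide)
  ultimately have "(flat_exp j \<longlongrightarrow> 0) (at_right 0)"
    by (rule Lim_transform_eventually)
  moreover have "(flat_exp j \<longlongrightarrow> 0) (at_left 0)"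
    by (rule tendsto_eventually) (auto simp: eventually_at_left_field flat_exp_def intro!: exI[of _ "-1"])
  ultimately show ?thesis by (simp add: filterlim_at_split)
qed

lemma DERIV_flat_exp:
  "(flat_exp j has_real_derivative flat_exp (j + 2) t - real j * flat_exp (Suc j) t) (at t)"
proof -
  consider "t > 0" | "t = 0" | "t < 0" by linarith
  then show ?thesis
  proof cases
    case 1
    have "((\<lambda>t. exp (- (1 / t)) / t ^ j) has_real_derivative
        (exp (- (1/t)) * (1 / t\<^sup>2) * t ^ j - exp (- (1/t)) * (real j * t ^ (j - 1))) / (t ^ j * t ^ j)) (at t)"
      using 1 by (auto intro!: derivative_eq_intros simp: power2_eq_square)
    moreover have "(exp (- (1/t)) * (1 / t\<^sup>2) * t ^ j - exp (- (1/t)) * (real j * t ^ (j - 1))) / (t ^ j * t ^ j)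
       = flat_exp (j + 2) t - real j * flat_exp (Suc j) t"
      using 1 by (cases j) (auto simp: flat_exp_def field_simps power2_eq_square)
    ultimately show ?thesis
      using 1 by (auto elim!: has_field_derivative_transform_within_open[where S = "{0<..}"] simp: flat_exp_def)
  next
    case 2
    \<comment> \<open>At the origin the difference quotient of the function with index
      \<open>j\<close> is the function with index \<open>Suc j\<close>, which tends to
      \<open>0\<close>.\<close>
    have "((\<lambda>h. flat_exp j h / h) \<longlongrightarrow> 0) (at 0)"
      using flat_exp_tendsto_0[of "Suc j"]
      by (rule Lim_transform_eventually) (auto simp: flat_exp_def eventually_at_filter field_simps)
    then show ?thesis using 2 by (simp add: DERIV_def flat_exp_def)
  next
    case 3
    have "((\<lambda>t. 0) has_real_derivative 0) (at t)" by simp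
    then show ?thesis
      using 3 has_field_derivative_transform_within_open[of "\<lambda>t. 0" 0 t "{..<0}" "flat_exp j"]
      by (simp add: flat_exp_def)
  qed
qed

lemma Ck_on_flat_exp:
  assumes "open S" shows "Ck_on m S u \<Longrightarrow> Ck_on m S (\<lambda>x. flat_exp j (u x))"
proof (induction m arbitrary: j)
  case 0
  have "continuous_on UNIV (flat_exp j)"
    by (meson DERIV_flat_exp DERIV_isCont continuous_at_imp_continuous_on)
  then show ?case using 0 continuous_on_compose2 by force
next
  case (Suc m)
  have "Ck_on m S (partial_deriv k (\<lambda>x. flat_exp j (u x)))" for k
    by (rule Ck_on_cong[OF \<open>open S\<close> _ Ck_on_mult[OF \<open>open S\<close> Ck_on_diff[OF \<open>open S\<close> Suc.IH
          Ck_on_mult[OF \<open>open S\<close> Ck_on_const Suc.IH]], of "partial_deriv k u" "j+2" "real j" "Suc j"]])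
      (use Suc.prems Ck_on_SucD[OF Suc.prems] in \<open>auto simp: partial_deriv_chain[OF DERIV_flat_exp]\<close>)
  then show ?case using Suc.prems by (auto intro: differentiable_chain_real[OF DERIV_flat_exp])
qed

section \<open>Compactly supported functions and integration by parts\<close>

text \<open>The order is finite because products such as \<open>c\<close> times a partial derivative
  are only C^1. Asking for some compact \<open>K\<close> instead of the closed support makes sums,
  products and derivatives easy to handle.\<close>

definition Ck_compact :: "nat \<Rightarrow> (real^'n::finite) set \<Rightarrow> (real^'n \<Rightarrow> real) \<Rightarrow> bool" where
  "Ck_compact m \<Omega> f \<longleftrightarrow> Ck_on m UNIV f \<and> (\<exists>K. compact K \<and> K \<subseteq> \<Omega> \<and> (\<forall>x. x \<notin> K \<longrightarrow> f x = 0))"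

lemma Ck_compactI: "Ck_on m UNIV f \<Longrightarrow> compact K \<Longrightarrow> K \<subseteq> \<Omega> \<Longrightarrow> (\<And>x. x \<notin> K \<Longrightarrow> f x = 0) \<Longrightarrow> Ck_compact m \<Omega> f"
  unfolding Ck_compact_def by blast

lemma test_functions_iff: "f \<in> test_functions \<Omega> \<longleftrightarrow> (\<forall>m. Ck_compact m \<Omega> f)"
proof
  assume "f \<in> test_functions \<Omega>"
  then show "\<forall>m. Ck_compact m \<Omega> f"
    using closure_subset[of "{x. f x \<noteq> 0}"]
    by (auto simp: test_functions_def C_k_iff_Ck_on Ck_compact_def intro!: exI[of _ "closure {x. f x \<noteq> 0}"])
next
  assume f: "\<forall>m. Ck_compact m \<Omega> f"
  then obtain K where K: "compact K" "K \<subseteq> \<Omega>" "\<And>x. x \<notin> K \<Longrightarrow> f x = 0"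
    unfolding Ck_compact_def by blast
  then have "closure {x. f x \<noteq> 0} \<subseteq> K"
    by (intro closure_minimal compact_imp_closed) auto
  then show "f \<in> test_functions \<Omega>"
    using f K by (auto simp: test_functions_def C_k_iff_Ck_on Ck_compact_def intro: closed_subset
        compact_closure[THEN iffD2] bounded_subset compact_imp_bounded
        bounded_subset[OF compact_imp_bounded, of K])
qed

lemma Ck_compact_SucD: "Ck_compact (Suc m) \<Omega> f \<Longrightarrow> Ck_compact m \<Omega> f"
  unfolding Ck_compact_def using Ck_on_SucD by blast

lemma Ck_compact_zero_outside: "Ck_compact m \<Omega> f \<Longrightarrow> x \<notin> \<Omega> \<Longrightarrow> f x = 0"
  unfolding Ck_compact_def by blast

lemma Ck_compact_continuous: "Ck_compact m \<Omega> f \<Longrightarrow> continuous_on UNIV f"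
  unfolding Ck_compact_def using Ck_on_le[of 0 m] by auto

lemma Ck_compact_add:
  assumes "Ck_compact m \<Omega> f" "Ck_compact m \<Omega> g" shows "Ck_compact m \<Omega> (\<lambda>x. f x + g x)"
proof -
  obtain K L where "compact K" "K \<subseteq> \<Omega>" "\<And>x. x \<notin> K \<Longrightarrow> f x = 0"
    "compact L" "L \<subseteq> \<Omega>" "\<And>x. x \<notin> L \<Longrightarrow> g x = 0"
    using assms unfolding Ck_compact_def by metis
  then show ?thesis
    using assms by (intro Ck_compactI[of _ _ "K \<union> L"]) (auto simp: Ck_compact_def intro: Ck_on_add)
qed

text \<open>The multiplier \<open>a\<close> need only be regular on \<open>\<Omega>\<close>. The
  product is regular there and is zero on the complement of \<open>K\<close>; these two open sets
  cover the space.\<close>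

lemma Ck_compact_mult:
  assumes "Ck_compact m \<Omega> f" "open \<Omega>" "Ck_on m \<Omega> a" shows "Ck_compact m \<Omega> (\<lambda>x. a x * f x)"
proof -
  obtain K where K: "compact K" "K \<subseteq> \<Omega>" "\<And>x. x \<notin> K \<Longrightarrow> f x = 0"
    using assms unfolding Ck_compact_def by metis
  have "open (- K)" using K(1) by (simp add: compact_imp_closed open_Compl)
  have "Ck_on m \<Omega> (\<lambda>x. a x * f x)"
    using assms by (intro Ck_on_mult) (auto simp: Ck_compact_def intro: Ck_on_subset)
  moreover have "Ck_on m (- K) (\<lambda>x. a x * f x)"
    by (rule Ck_on_cong[OF \<open>open (- K)\<close> _ Ck_on_const[of _ _ 0]]) (simp add: K)
  ultimately have "Ck_on m (\<Omega> \<union> - K) (\<lambda>x. a x * f x)"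
    using \<open>open (- K)\<close> assms(2) by (intro Ck_on_Un)
  moreover have "\<Omega> \<union> - K = UNIV" using K by auto
  ultimately show ?thesis using K by (intro Ck_compactI[of _ _ K]) auto
qed

lemma Ck_compact_cmult: "Ck_compact m \<Omega> f \<Longrightarrow> Ck_compact m \<Omega> (\<lambda>x. a * f x)"
  unfolding Ck_compact_def by (force intro: Ck_on_mult Ck_on_const)

lemma Ck_compact_diff:
  assumes "Ck_compact m \<Omega> f" "Ck_compact m \<Omega> g" shows "Ck_compact m \<Omega> (\<lambda>x. f x - g x)"
  using Ck_compact_add[OF assms(1) Ck_compact_cmult[OF assms(2), of "- 1"]] by simp

lemma Ck_compact_sum:
  assumes "\<And>i. i \<in> I \<Longrightarrow> Ck_compact m \<Omega> (f i)" shows "Ck_compact m \<Omega> (\<lambda>x. \<Sum>i\<in>I. f i x)"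
  using assms
proof (induction I rule: infinite_finite_induct)
  case (insert i I)
  then show ?case using Ck_compact_add[of m \<Omega> "f i"] by simp
qed (auto intro: Ck_on_const Ck_compactI[of _ _ "{}"])

lemma Ck_compact_partial_deriv:
  assumes "Ck_compact (Suc m) \<Omega> f" shows "Ck_compact m \<Omega> (partial_deriv k f)"
proof -
  obtain K where K: "compact K" "K \<subseteq> \<Omega>" "\<And>x. x \<notin> K \<Longrightarrow> f x = 0"
    using assms unfolding Ck_compact_def by metis
  have "open (- K)" using K(1) by (simp add: compact_imp_closed open_Compl)
  then have "partial_deriv k f x = 0" if "x \<notin> K" for x
    using partial_deriv_cong_open[of "- K" x f "\<lambda>x. 0" k] that K by (simp add: partial_deriv_const)
  then show ?thesis
    using assms K by (intro Ck_compactI[of _ _ K]) (auto simp: Ck_compact_def)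
qed

lemma Ck_compact_differentiable: "Ck_compact (Suc m) \<Omega> f \<Longrightarrow> f differentiable at x"
  unfolding Ck_compact_def by simp

lemma Ck_compact_measurable: "Ck_compact m \<Omega> f \<Longrightarrow> f \<in> borel_measurable borel"
  by (rule borel_measurable_continuous_onI[OF Ck_compact_continuous])

section \<open>Integrability, and vanishing integrals of partial derivatives\<close>

lemma Ck_compact_bounded:
  assumes "Ck_compact m \<Omega> f" obtains B where "\<And>x. \<bar>f x\<bar> \<le> B"
proof -
  obtain K where K: "compact K" "K \<subseteq> \<Omega>" "\<And>x. x \<notin> K \<Longrightarrow> f x = 0"
    using assms unfolding Ck_compact_def by metis
  have "compact (f ` K)"
    using Ck_compact_continuous[OF assms] K(1) by (intro compact_continuous_image)
      (auto intro: continuous_on_subset)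
  then obtain B where "\<forall>y\<in>f ` K. norm y \<le> B"
    using compact_imp_bounded bounded_iff by metis
  then have "\<bar>f x\<bar> \<le> max B 0" for x
    using K(3)[of x] by (cases "x \<in> K") force+
  then show ?thesis using that by blast
qed

lemma Ck_compact_support_bounded:
  assumes "Ck_compact m \<Omega> f" obtains R where "\<And>x. norm x > R \<Longrightarrow> f x = 0"
proof -
  obtain K where K: "compact K" "K \<subseteq> \<Omega>" "\<And>x. x \<notin> K \<Longrightarrow> f x = 0"
    using assms unfolding Ck_compact_def by metis
  then obtain R where "\<forall>x\<in>K. norm x \<le> R"
    using compact_imp_bounded bounded_iff by metis
  then show ?thesis using K that[of R] by force
qed

lemma integrable_cball_const: "integrable lborel (\<lambda>x::real^'n::finite. B * indicator (cball 0 R) x :: real)"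
  using emeasure_bounded_finite[OF bounded_cball, of "0 :: real^'n" R]
  by (intro integrable_mult_right integrable_real_indicator) auto

lemma Ck_compact_integrable_lborel:
  assumes "Ck_compact m \<Omega> f" shows "integrable lborel f"
proof -
  obtain B where B: "\<And>x. \<bar>f x\<bar> \<le> B" using Ck_compact_bounded[OF assms] by blast
  obtain R where R: "\<And>x. norm x > R \<Longrightarrow> f x = 0" using Ck_compact_support_bounded[OF assms] by blast
  show ?thesis
  proof (rule Bochner_Integration.integrable_bound[OF integrable_cball_const[of B R]])
    show "f \<in> borel_measurable lborel" using Ck_compact_measurable[OF assms] by simp
    show "AE x in lborel. norm (f x) \<le> norm (B * indicator (cball 0 R) x)"
    proof (rule AE_I2)
      fix x show "norm (f x) \<le> norm (B * indicator (cball 0 R) x)"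
        using B[of x] R[of x] by (cases "norm x > R") (auto simp: indicator_def)
    qed
  qed
qed

lemma DERIV_along_axis:
  assumes "w differentiable at (x + t *\<^sub>R axis k 1)"
  shows "((\<lambda>t. w (x + t *\<^sub>R axis k 1)) has_real_derivative partial_deriv k w (x + t *\<^sub>R axis k 1)) (at t)"
proof -
  let ?W = "frechet_derivative w (at (x + t *\<^sub>R axis k 1))"
  have W: "(w has_derivative ?W) (at (x + t *\<^sub>R axis k 1))"
    using assms by (simp add: frechet_derivative_works)
  have "((\<lambda>t. w (x + t *\<^sub>R axis k 1)) has_derivative (\<lambda>h. ?W (h *\<^sub>R axis k 1))) (at t)"
    by (rule has_derivative_compose[where g = w and f = "\<lambda>t. x + t *\<^sub>R axis k 1" and x = t, OF _ W]) (auto intro!: derivative_eq_intros)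
  moreover have "(\<lambda>h. ?W (h *\<^sub>R axis k 1)) = (*) (partial_deriv k w (x + t *\<^sub>R axis k 1))"
    using linear_cmul[OF has_derivative_linear[OF W]] by (auto simp: partial_deriv_def)
  ultimately show ?thesis by (simp add: has_field_derivative_def)
qed

text \<open>Translation invariance makes the integral of every difference quotient vanish.\<close>

lemma integral_partial_deriv_eq_0:
  fixes w :: "real^'n::finite \<Rightarrow> real"
  assumes w: "Ck_compact (Suc 0) \<Omega> w"
  shows "(\<integral>x. partial_deriv k w x \<partial>lborel) = 0"
proof -
  define e :: "real^'n" where "e = axis k 1"
  define h where "h n = 1 / real (Suc n)" for n
  define s where "s n x = (w (x + h n *\<^sub>R e) - w x) / h n" for n x
  have h: "0 < h n" "h n \<le> 1" for n by (auto simp: h_def)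
  note dw = Ck_compact_partial_deriv[OF w, of k]
  obtain B where B: "\<And>x. \<bar>partial_deriv k w x\<bar> \<le> B" using Ck_compact_bounded[OF dw] by blast
  obtain R where R: "\<And>x. norm x > R \<Longrightarrow> w x = 0" using Ck_compact_support_bounded[OF w] by blast
  have D: "((\<lambda>t. w (x + t *\<^sub>R e)) has_real_derivative partial_deriv k w (x + t *\<^sub>R e)) (at t)" for x t
    unfolding e_def by (intro DERIV_along_axis Ck_compact_differentiable[OF w])
  have int0: "(\<integral>x. s n x \<partial>lborel) = 0" for n
  proof -
    have wm: "w \<in> borel_measurable borel" using Ck_compact_measurable[OF w] .
    have d: "distr lborel borel (\<lambda>x. h n *\<^sub>R e + x) = (lborel :: (real^'n) measure)"
      using lborel_distr_plus[of "h n *\<^sub>R e"] by simp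
    have "integrable (distr lborel borel (\<lambda>x. h n *\<^sub>R e + x)) w"
      unfolding d by (rule Ck_compact_integrable_lborel[OF w])
    then have i: "integrable lborel (\<lambda>x. w (x + h n *\<^sub>R e))"
      by (subst (asm) integrable_distr_eq) (use wm in \<open>auto simp: add.commute\<close>)
    have "(\<integral>x. w x \<partial>lborel) = (\<integral>x. w x \<partial>(distr lborel borel (\<lambda>x. h n *\<^sub>R e + x)))"
      unfolding d ..
    also have "\<dots> = (\<integral>x. w (x + h n *\<^sub>R e) \<partial>lborel)"
      by (subst integral_distr) (use wm in \<open>auto simp: add.commute\<close>)
    finally show ?thesis
      unfolding s_def using i Ck_compact_integrable_lborel[OF w] by simp
  qed
  have "(\<lambda>n. \<integral>x. s n x \<partial>lborel) \<longlonglongrightarrow> (\<integral>x. partial_deriv k w x \<partial>lborel)"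
  proof (rule integral_dominated_convergence)
    have wm[measurable]: "w \<in> borel_measurable borel" using Ck_compact_measurable[OF w] .
    show "s n \<in> borel_measurable lborel" for n unfolding s_def[abs_def] by measurable
    show "partial_deriv k w \<in> borel_measurable lborel" using Ck_compact_measurable[OF dw] by simp
    \<comment> \<open>The majorant: the step sizes are at most \<open>1\<close>, so every difference
      quotient vanishes beyond radius \<open>R + 1\<close>, and elsewhere the mean value theorem
      bounds it by \<open>B\<close>.\<close>
    show "integrable lborel (\<lambda>x::real^'n. B * indicator (cball 0 (R + 1)) x)"
      by (rule integrable_cball_const)
    have hn: "filterlim h (at 0) sequentially"
      unfolding filterlim_at using h LIMSEQ_inverse_real_of_nat
      by (auto simp: h_def[abs_def] inverse_eq_divide)
    show "AE x in lborel. (\<lambda>n. s n x) \<longlonglongrightarrow> partial_deriv k w x"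
    proof (rule AE_I2)
      fix x
      have "((\<lambda>t. (w (x + t *\<^sub>R e) - w x) / t) \<longlongrightarrow> partial_deriv k w x) (at 0)"
        using D[of x 0] by (simp add: DERIV_def)
      from filterlim_compose[OF this hn] show "(\<lambda>n. s n x) \<longlonglongrightarrow> partial_deriv k w x"
        by (simp add: s_def)
    qed
    show "AE x in lborel. norm (s n x) \<le> B * indicator (cball 0 (R + 1)) x" for n
    proof (rule AE_I2)
      fix x
      show "norm (s n x) \<le> B * indicator (cball 0 (R + 1)) x"
      proof (cases "norm x \<le> R + 1")
        case True
        have "\<exists>z>0. z < h n \<and> w (x + h n *\<^sub>R e) - w (x + 0 *\<^sub>R e) = (h n - 0) * partial_deriv k w (x + z *\<^sub>R e)"
          by (rule MVT2[OF h(1)]) (rule D)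
        then obtain z where "w (x + h n *\<^sub>R e) - w (x + 0 *\<^sub>R e) = (h n - 0) * partial_deriv k w (x + z *\<^sub>R e)"
          by blast
        then have "s n x = partial_deriv k w (x + z *\<^sub>R e)"
          using h(1)[of n] by (simp add: s_def)
        then show ?thesis using B True by simp
      next
        case False
        have "norm (x + h n *\<^sub>R e) \<ge> norm x - norm (h n *\<^sub>R e)"
          by (metis norm_diff_ineq)
        moreover have "norm (h n *\<^sub>R e) \<le> 1" using h[of n] by (simp add: e_def)
        ultimately have "w (x + h n *\<^sub>R e) = 0" "w x = 0"
          using False by (auto intro!: R)
        then show ?thesis using False by (simp add: s_def)
      qed
    qed
  qed
  then show ?thesis by (simp add: int0 LIMSEQ_const_iff)
qed

text \<open>Passes from the completed, restricted measure of the form to \<open>lborel\<close>,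
  where translations and dilations act.\<close>

lemma integral_lebesgue_on_eq_lborel:
  fixes f :: "real^'n::finite \<Rightarrow> real"
  assumes "open \<Omega>" "f \<in> borel_measurable borel" "\<And>x. x \<notin> \<Omega> \<Longrightarrow> f x = 0"
  shows "(\<integral>x. f x \<partial>lebesgue_on \<Omega>) = (\<integral>x. f x \<partial>lborel)"
    and "integrable (lebesgue_on \<Omega>) f \<longleftrightarrow> integrable lborel f"
proof -
  have "(\<lambda>x. indicator \<Omega> x *\<^sub>R f x) = f"
  proof
    fix x show "indicator \<Omega> x *\<^sub>R f x = f x" using assms(3)[of x] by (cases "x \<in> \<Omega>") auto
  qed
  then show "(\<integral>x. f x \<partial>lebesgue_on \<Omega>) = (\<integral>x. f x \<partial>lborel)"
    "integrable (lebesgue_on \<Omega>) f \<longleftrightarrow> integrable lborel f"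
    using assms by (simp_all add: integral_restrict_space integrable_restrict_space
        integral_completion integrable_completion)
qed

lemma Ck_compact_integrable:
  assumes "open \<Omega>" "Ck_compact m \<Omega> f" shows "integrable (lebesgue_on \<Omega>) f"
  using integral_lebesgue_on_eq_lborel(2)[OF assms(1) Ck_compact_measurable[OF assms(2)]]
    Ck_compact_zero_outside[OF assms(2)] Ck_compact_integrable_lborel[OF assms(2)] by simp

lemma integral_lebesgue_on_partial_deriv_eq_0:
  assumes "open \<Omega>" "Ck_compact (Suc 0) \<Omega> w"
  shows "(\<integral>x. partial_deriv k w x \<partial>lebesgue_on \<Omega>) = 0"
  using integral_lebesgue_on_eq_lborel(1)[OF assms(1), of "partial_deriv k w"]
    Ck_compact_zero_outside[OF Ck_compact_partial_deriv[OF assms(2)]]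
    Ck_compact_measurable[OF Ck_compact_partial_deriv[OF assms(2)]]
    integral_partial_deriv_eq_0[OF assms(2)] by simp

section \<open>Closability and the closed form\<close>

text \<open>Minimising the right-hand side over \<open>t\<close> would give
  \<open>(sqrt b + sqrt d)\<^sup>2\<close> at \<open>t = sqrt d / sqrt b\<close>. Adding a small
  \<open>s\<close> to both roots keeps this ratio positive and finite; it costs
  \<open>s * (p + r)\<close>, which the choice of \<open>s\<close> makes at most \<open>e\<close>.
  In this way the triangle inequality for the form follows from a pointwise estimate.\<close>

lemma sqrt_triangle_of_weighted:
  fixes a b d :: real
  assumes "0 \<le> b" "0 \<le> d" and le: "\<And>t. t > 0 \<Longrightarrow> a \<le> (1 + t) * b + (1 + 1 / t) * d"
  shows "sqrt a \<le> sqrt b + sqrt d"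
proof -
  have "a \<le> (sqrt b + sqrt d)\<^sup>2"
  proof (rule field_le_epsilon)
    fix e :: real assume e: "e > 0"
    define p where "p = sqrt b"
    define r where "r = sqrt d"
    define s where "s = e / (p + r + 1)"
    have pr: "p \<ge> 0" "r \<ge> 0" "b = p\<^sup>2" "d = r\<^sup>2" using assms by (auto simp: p_def r_def)
    have s: "s > 0" using e pr by (auto simp: s_def intro!: divide_pos_pos)
    have "p\<^sup>2 / (p + s) \<le> p" "r\<^sup>2 / (r + s) \<le> r"
      using pr s by (auto simp: divide_simps power2_eq_square algebra_simps add_nonneg_eq_0_iff)
    then have "(r + s) * (p\<^sup>2 / (p + s)) + (p + s) * (r\<^sup>2 / (r + s)) \<le> (r + s) * p + (p + s) * r"
      using pr s by (intro add_mono mult_left_mono) auto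
    moreover have "s * (p + r) \<le> e"
      using e pr by (auto simp: s_def divide_simps algebra_simps)
    moreover have "a \<le> p\<^sup>2 + r\<^sup>2 + ((r + s) * (p\<^sup>2 / (p + s)) + (p + s) * (r\<^sup>2 / (r + s)))"
      using le[of "(r + s) / (p + s)"] pr s by (simp add: algebra_simps)
    ultimately show "a \<le> (sqrt b + sqrt d)\<^sup>2 + e"
      unfolding p_def[symmetric] r_def[symmetric] by (simp add: power2_eq_square algebra_simps)
  qed
  then show ?thesis using assms(1,2) by (intro real_le_lsqrt) auto
qed

lemma Ck_compact_mult':
  assumes "open \<Omega>" "Ck_compact m \<Omega> f" "Ck_compact m \<Omega> g" shows "Ck_compact m \<Omega> (\<lambda>x. f x * g x)"
  using Ck_compact_mult[OF assms(3,1)] assms(2) unfolding Ck_compact_def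
  by (blast intro: Ck_on_subset)

lemma Ck_compact_L2:
  assumes "open \<Omega>" "Ck_compact m \<Omega> f" shows "f \<in> L2_space (lebesgue_on \<Omega>)"
  unfolding L2_space_def
  using Ck_compact_integrable[OF assms(1) Ck_compact_mult'[OF assms(1,2,2)]]
    Ck_compact_integrable[OF assms] by (auto simp: power2_eq_square)

lemma L2_diff_square_integrable:
  assumes "f \<in> L2_space M" "g \<in> L2_space M"
  shows "integrable M (\<lambda>x. (f x - g x)\<^sup>2)"
proof (rule Bochner_Integration.integrable_bound)
  show "integrable M (\<lambda>x. 2 * (f x)\<^sup>2 + 2 * (g x)\<^sup>2)"
    using assms unfolding L2_space_def by auto
  show "(\<lambda>x. (f x - g x)\<^sup>2) \<in> borel_measurable M"
    using assms unfolding L2_space_def by auto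
  have "(f x - g x)\<^sup>2 \<le> 2 * (f x)\<^sup>2 + 2 * (g x)\<^sup>2" for x
    using zero_le_power2[of "f x + g x"] by (simp add: power2_eq_square algebra_simps)
  then show "AE x in M. norm ((f x - g x)\<^sup>2) \<le> norm (2 * (f x)\<^sup>2 + 2 * (g x)\<^sup>2)"
    by simp
qed

text \<open>A C^1 coefficient is what makes the flux \<open>c y * partial_deriv k u y\<close> of a
  C^2 function differentiable once more, as closability requires.\<close>

locale weighted_form =
  fixes \<Omega> :: "(real^'n::finite) set" and c :: "real^'n \<Rightarrow> real"
  assumes open_domain: "open \<Omega>" and coeff: "Ck_on (Suc 0) \<Omega> c" and coeff_nonneg: "\<And>x. 0 \<le> c x"
begin

lemma Ck_compact_energy_density:
  assumes "Ck_compact (Suc 0) \<Omega> u" "Ck_compact (Suc 0) \<Omega> v"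
  shows "Ck_compact 0 \<Omega> (\<lambda>x. partial_deriv k u x * (c x * partial_deriv k v x))"
  by (intro Ck_compact_mult'[OF open_domain, of 0] Ck_compact_mult[OF _ open_domain]
      Ck_compact_partial_deriv assms Ck_on_SucD[OF coeff])

lemmas integrable_energy = Ck_compact_integrable[OF open_domain Ck_compact_energy_density]

lemma pre_form_nonneg: "0 \<le> pre_form \<Omega> c u"
  unfolding pre_form_def L2_inner_def using coeff_nonneg
  by (intro sum_nonneg Bochner_Integration.integral_nonneg) (simp add: mult.left_commute[of _ "c _"])

lemma sqrt_pre_form_triangle:
  assumes u: "Ck_compact (Suc 0) \<Omega> u" and v: "Ck_compact (Suc 0) \<Omega> v"
  shows "sqrt (pre_form \<Omega> c u) \<le> sqrt (pre_form \<Omega> c v) + sqrt (pre_form \<Omega> c (\<lambda>x. u x - v x))"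
proof (rule sqrt_triangle_of_weighted)
  fix t :: real assume t: "t > 0"
  let ?w = "\<lambda>x. u x - v x"
  have w: "Ck_compact (Suc 0) \<Omega> ?w" using assms by (rule Ck_compact_diff)
  \<comment> \<open>With \<open>a = b + (a - b)\<close>, the difference of the two sides is a
    completed square.\<close>
  have pw: "a * (z * a) \<le> (1 + t) * (b * (z * b)) + (1 + 1 / t) * ((a - b) * (z * (a - b)))"
    if "z \<ge> 0" for z a b :: real
  proof -
    have "(1 + t) * (b * (z * b)) + (1 + 1 / t) * ((a - b) * (z * (a - b))) - a * (z * a)
      = z / t * (t * b - (a - b))\<^sup>2"
      using t by (simp add: field_simps power2_eq_square)
    moreover have "0 \<le> z / t * (t * b - (a - b))\<^sup>2" using that t by simp
    ultimately show ?thesis by linarith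
  qed
  have "L2_inner (lebesgue_on \<Omega>) (partial_deriv k u) (\<lambda>x. c x * partial_deriv k u x)
     \<le> (1 + t) * L2_inner (lebesgue_on \<Omega>) (partial_deriv k v) (\<lambda>x. c x * partial_deriv k v x)
     + (1 + 1 / t) * L2_inner (lebesgue_on \<Omega>) (partial_deriv k ?w) (\<lambda>x. c x * partial_deriv k ?w x)" for k
  proof -
    have "L2_inner (lebesgue_on \<Omega>) (partial_deriv k u) (\<lambda>x. c x * partial_deriv k u x)
      \<le> (\<integral>x. (1 + t) * (partial_deriv k v x * (c x * partial_deriv k v x))
        + (1 + 1 / t) * (partial_deriv k ?w x * (c x * partial_deriv k ?w x)) \<partial>lebesgue_on \<Omega>)"
      unfolding L2_inner_def
    proof (rule integral_mono)
      fix x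
      have "partial_deriv k ?w x = partial_deriv k u x - partial_deriv k v x"
        using u v by (intro partial_deriv_diff Ck_compact_differentiable)
      then show "partial_deriv k u x * (c x * partial_deriv k u x)
        \<le> (1 + t) * (partial_deriv k v x * (c x * partial_deriv k v x))
        + (1 + 1 / t) * (partial_deriv k ?w x * (c x * partial_deriv k ?w x))"
        using pw[OF coeff_nonneg] by simp
    qed (intro integrable_energy u v w Bochner_Integration.integrable_add integrable_mult_right)+
    then show ?thesis
      unfolding L2_inner_def
      by (subst (asm) Bochner_Integration.integral_add)
        (intro integrable_energy u v w integrable_mult_right | simp)+
  qed
  then show "pre_form \<Omega> c u \<le> (1 + t) * pre_form \<Omega> c v + (1 + 1 / t) * pre_form \<Omega> c ?w"
    unfolding pre_form_def sum_distrib_left sum.distrib[symmetric] by (intro sum_mono)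
qed (rule pre_form_nonneg)+

lemma pre_form_diff_commute:
  assumes "Ck_compact (Suc 0) \<Omega> u" "Ck_compact (Suc 0) \<Omega> v"
  shows "pre_form \<Omega> c (\<lambda>x. u x - v x) = pre_form \<Omega> c (\<lambda>x. v x - u x)"
  using assms unfolding pre_form_def L2_inner_def
  by (simp add: partial_deriv_diff[OF Ck_compact_differentiable Ck_compact_differentiable] algebra_simps)

lemma abs_sqrt_pre_form_diff_le:
  assumes "Ck_compact (Suc 0) \<Omega> u" "Ck_compact (Suc 0) \<Omega> v"
  shows "\<bar>sqrt (pre_form \<Omega> c u) - sqrt (pre_form \<Omega> c v)\<bar> \<le> sqrt (pre_form \<Omega> c (\<lambda>x. u x - v x))"
  using sqrt_pre_form_triangle[OF assms] sqrt_pre_form_triangle[OF assms(2,1)]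
    pre_form_diff_commute[OF assms] by simp

text \<open>The divergence-form operator \<open>div (c grad u)\<close>; up to sign it represents the
  form on test functions.\<close>

definition elliptic_op :: "(real^'n \<Rightarrow> real) \<Rightarrow> real^'n \<Rightarrow> real" where
  "elliptic_op u x = (\<Sum>k\<in>UNIV. partial_deriv k (\<lambda>y. c y * partial_deriv k u y) x)"

lemma Ck_compact_flux:
  assumes "Ck_compact (Suc (Suc 0)) \<Omega> u"
  shows "Ck_compact (Suc 0) \<Omega> (\<lambda>y. c y * partial_deriv k u y)"
  by (intro Ck_compact_mult[OF _ open_domain coeff] Ck_compact_partial_deriv assms)

lemma Ck_compact_elliptic_op:
  assumes "Ck_compact (Suc (Suc 0)) \<Omega> u" shows "Ck_compact 0 \<Omega> (elliptic_op u)"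
  unfolding elliptic_op_def[abs_def]
  using assms by (intro Ck_compact_sum Ck_compact_partial_deriv Ck_compact_flux)

text \<open>Green's formula: the field \<open>v c grad u\<close> is C^1 with compact support, so its
  divergence has integral zero.\<close>

lemma energy_eq_elliptic_op:
  assumes u: "Ck_compact (Suc (Suc 0)) \<Omega> u" and v: "Ck_compact (Suc 0) \<Omega> v"
  shows "(\<Sum>k\<in>UNIV. \<integral>x. partial_deriv k v x * (c x * partial_deriv k u x) \<partial>lebesgue_on \<Omega>)
    = - (\<integral>x. v x * elliptic_op u x \<partial>lebesgue_on \<Omega>)"
proof -
  note u1 = Ck_compact_SucD[OF u]
  note fl = Ck_compact_flux[OF u]
  have i: "integrable (lebesgue_on \<Omega>) (\<lambda>x. v x * partial_deriv k (\<lambda>y. c y * partial_deriv k u y) x)" for k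
    by (intro Ck_compact_integrable[OF open_domain Ck_compact_mult'[OF open_domain, of 0]]
        Ck_compact_SucD[OF v] Ck_compact_partial_deriv[OF fl])
  have "(\<integral>x. partial_deriv k v x * (c x * partial_deriv k u x) \<partial>lebesgue_on \<Omega>)
    = - (\<integral>x. v x * partial_deriv k (\<lambda>y. c y * partial_deriv k u y) x \<partial>lebesgue_on \<Omega>)" for k
  proof -
    have "0 = (\<integral>x. partial_deriv k (\<lambda>x. v x * (c x * partial_deriv k u x)) x \<partial>lebesgue_on \<Omega>)"
      using integral_lebesgue_on_partial_deriv_eq_0[OF open_domain Ck_compact_mult'[OF open_domain v fl]]
      by simp
    also have "\<dots> = (\<integral>x. partial_deriv k v x * (c x * partial_deriv k u x)
        + v x * partial_deriv k (\<lambda>y. c y * partial_deriv k u y) x \<partial>lebesgue_on \<Omega>)"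
      by (intro Bochner_Integration.integral_cong refl partial_deriv_mult
          Ck_compact_differentiable[OF v] Ck_compact_differentiable[OF fl])
    also have "\<dots> = (\<integral>x. partial_deriv k v x * (c x * partial_deriv k u x) \<partial>lebesgue_on \<Omega>)
      + (\<integral>x. v x * partial_deriv k (\<lambda>y. c y * partial_deriv k u y) x \<partial>lebesgue_on \<Omega>)"
      by (intro Bochner_Integration.integral_add i integrable_energy u1 v)
    finally show ?thesis by simp
  qed
  then show ?thesis
    unfolding elliptic_op_def sum_distrib_left using i
    by (simp add: sum_negf Bochner_Integration.integral_sum)
qed

text \<open>Expanding the form at \<open>u - v\<close> and dropping the nonnegative energy of
  \<open>v\<close> leaves twice the energy pairing of \<open>u\<close> and \<open>v\<close>. Green's
  formula turns it into an L2 pairing of \<open>v\<close> with \<open>elliptic_op u\<close>, which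
  is split by Young's inequality with parameter \<open>s\<close>. No derivative of \<open>v\<close>
  remains outside \<open>u - v\<close>.\<close>

lemma pre_form_le_diff:
  assumes u: "Ck_compact (Suc (Suc 0)) \<Omega> u" and v: "Ck_compact (Suc 0) \<Omega> v" and s: "s > 0"
  shows "pre_form \<Omega> c u \<le> pre_form \<Omega> c (\<lambda>x. u x - v x)
    + s * L2_inner (lebesgue_on \<Omega>) (elliptic_op u) (elliptic_op u)
    + L2_inner (lebesgue_on \<Omega>) v v / s"
proof -
  let ?M = "lebesgue_on \<Omega>" and ?w = "\<lambda>x. u x - v x"
  note u1 = Ck_compact_SucD[OF u]
  have w: "Ck_compact (Suc 0) \<Omega> ?w" using u1 v by (rule Ck_compact_diff)
  have "(\<integral>x. partial_deriv k u x * (c x * partial_deriv k u x) \<partial>?M)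
     \<le> (\<integral>x. partial_deriv k ?w x * (c x * partial_deriv k ?w x) \<partial>?M)
       + 2 * (\<integral>x. partial_deriv k v x * (c x * partial_deriv k u x) \<partial>?M)" for k
  proof -
    have "(\<integral>x. partial_deriv k u x * (c x * partial_deriv k u x) \<partial>?M)
      \<le> (\<integral>x. partial_deriv k ?w x * (c x * partial_deriv k ?w x)
        + 2 * (partial_deriv k v x * (c x * partial_deriv k u x)) \<partial>?M)"
    proof (rule integral_mono)
      fix x
      have dw: "partial_deriv k ?w x = partial_deriv k u x - partial_deriv k v x"
        using u1 v by (intro partial_deriv_diff Ck_compact_differentiable)
      have "partial_deriv k ?w x * (c x * partial_deriv k ?w x)
        + 2 * (partial_deriv k v x * (c x * partial_deriv k u x))
        - partial_deriv k u x * (c x * partial_deriv k u x)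
        = c x * (partial_deriv k v x)\<^sup>2"
        unfolding dw by (simp add: power2_eq_square algebra_simps)
      moreover have "0 \<le> c x * (partial_deriv k v x)\<^sup>2" using coeff_nonneg[of x] by simp
      ultimately show "partial_deriv k u x * (c x * partial_deriv k u x)
        \<le> partial_deriv k ?w x * (c x * partial_deriv k ?w x)
        + 2 * (partial_deriv k v x * (c x * partial_deriv k u x))"
        by linarith
    qed (intro integrable_energy u1 v w Bochner_Integration.integrable_add integrable_mult_right)+
    then show ?thesis
      by (subst (asm) Bochner_Integration.integral_add)
        (intro integrable_energy u1 v w integrable_mult_right | simp)+
  qed
  then have "pre_form \<Omega> c u \<le> (\<Sum>k\<in>UNIV. (\<integral>x. partial_deriv k ?w x * (c x * partial_deriv k ?w x) \<partial>?M)
       + 2 * (\<integral>x. partial_deriv k v x * (c x * partial_deriv k u x) \<partial>?M))"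
    unfolding pre_form_def L2_inner_def by (intro sum_mono)
  also have "\<dots> = pre_form \<Omega> c ?w + 2 * - (\<integral>x. v x * elliptic_op u x \<partial>?M)"
    unfolding energy_eq_elliptic_op[OF u v, symmetric]
    by (simp add: pre_form_def L2_inner_def sum.distrib sum_distrib_left)
  also have "2 * - (\<integral>x. v x * elliptic_op u x \<partial>?M) = (\<integral>x. - 2 * (v x * elliptic_op u x) \<partial>?M)"
    by simp
  also have "\<dots> \<le> (\<integral>x. s * (elliptic_op u x * elliptic_op u x) + v x * v x / s \<partial>?M)"
  proof (rule integral_mono)
    note l = Ck_compact_elliptic_op[OF u] and v0 = Ck_compact_SucD[OF v]
    show "integrable ?M (\<lambda>x. - 2 * (v x * elliptic_op u x))"
      by (intro integrable_mult_right Ck_compact_integrable[OF open_domain, of 0]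
          Ck_compact_mult'[OF open_domain, of 0] l v0)
    show "integrable ?M (\<lambda>x. s * (elliptic_op u x * elliptic_op u x) + v x * v x / s)"
      by (intro integrable_mult_right Ck_compact_integrable[OF open_domain, of 0] integrable_divide
          Ck_compact_mult'[OF open_domain, of 0] l v0 Bochner_Integration.integrable_add)
    fix x
    have "s * (elliptic_op u x * elliptic_op u x) + v x * v x / s - - 2 * (v x * elliptic_op u x)
      = (s * elliptic_op u x + v x)\<^sup>2 / s"
      using s by (simp add: field_simps power2_eq_square)
    moreover have "0 \<le> (s * elliptic_op u x + v x)\<^sup>2 / s" using s by simp
    ultimately show "- 2 * (v x * elliptic_op u x) \<le> s * (elliptic_op u x * elliptic_op u x) + v x * v x / s"
      by linarith
  qed
  also have "\<dots> = s * L2_inner ?M (elliptic_op u) (elliptic_op u) + L2_inner ?M v v / s"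
  proof -
    note l = Ck_compact_elliptic_op[OF u] and v0 = Ck_compact_SucD[OF v]
    show ?thesis unfolding L2_inner_def
      by (subst Bochner_Integration.integral_add)
       (intro integrable_mult_right Ck_compact_integrable[OF open_domain, of 0] integrable_divide
          Ck_compact_mult'[OF open_domain, of 0] l v0 | simp)+
  qed
  finally show ?thesis by simp
qed

text \<open>Closability: for fixed \<open>n\<close> the energy pairing of \<open>u n\<close> with \<open>u m\<close> is, after one
  integration by parts, an \<open>L\<^sub>2\<close> pairing of \<open>u m\<close> with a fixed function, and so tends
  to \<open>0\<close> with \<open>m\<close>.\<close>

lemma pre_form_tendsto_0:
  assumes u: "\<And>n. u n \<in> test_functions \<Omega>"
    and L2: "(\<lambda>n. L2_inner (lebesgue_on \<Omega>) (u n) (u n)) \<longlonglongrightarrow> 0"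
    and Cau: "\<And>e. e > 0 \<Longrightarrow> \<exists>N. \<forall>m\<ge>N. \<forall>n\<ge>N. pre_form \<Omega> c (\<lambda>x. u m x - u n x) < e"
  shows "(\<lambda>n. pre_form \<Omega> c (u n)) \<longlonglongrightarrow> 0"
proof (rule LIMSEQ_I)
  fix e :: real assume e: "e > 0"
  obtain N where N: "\<And>m n. m \<ge> N \<Longrightarrow> n \<ge> N \<Longrightarrow> pre_form \<Omega> c (\<lambda>x. u m x - u n x) < e / 2"
    using Cau[of "e / 2"] e by auto
  have "norm (pre_form \<Omega> c (u n) - 0) < e" if "n \<ge> N" for n
  proof -
    define G where "G = L2_inner (lebesgue_on \<Omega>) (elliptic_op (u n)) (elliptic_op (u n))"
    have G: "G \<ge> 0" unfolding G_def L2_inner_def by simp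
    \<comment> \<open>The \<open>1\<close> covers \<open>G = 0\<close>. Since \<open>s\<close>
      depends on \<open>n\<close> only, \<open>m\<close> can be chosen afterwards; the three terms
      are then below \<open>e / 2\<close>, at most \<open>e / 4\<close>, and below
      \<open>e / 4\<close>.\<close>
    define s where "s = e / (4 * (G + 1))"
    have s: "s > 0" "s * G \<le> e / 4" using e G by (auto simp: s_def field_simps)
    have "\<forall>\<^sub>F m in sequentially. L2_inner (lebesgue_on \<Omega>) (u m) (u m) < s * e / 4"
      using order_tendstoD(2)[OF L2, of "s * e / 4"] s(1) e by simp
    from eventually_happens'[OF sequentially_bot eventually_conj[OF this eventually_ge_at_top[of N]]]
    obtain m where m: "m \<ge> N" "L2_inner (lebesgue_on \<Omega>) (u m) (u m) < s * e / 4"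
      by blast
    then have "L2_inner (lebesgue_on \<Omega>) (u m) (u m) / s < e / 4" using s by (simp add: field_simps)
    moreover have "pre_form \<Omega> c (u n) \<le> pre_form \<Omega> c (\<lambda>x. u n x - u m x) + s * G
      + L2_inner (lebesgue_on \<Omega>) (u m) (u m) / s"
      unfolding G_def using u s by (intro pre_form_le_diff) (auto simp: test_functions_iff)
    ultimately have "pre_form \<Omega> c (u n) < e" using N[OF that m(1)] s(2) by linarith
    then show ?thesis using pre_form_nonneg[of "u n"] by simp
  qed
  then show "\<exists>N. \<forall>n\<ge>N. norm (pre_form \<Omega> c (u n) - 0) < e" by blast
qed

section \<open>Independence of the approximating sequence\<close>

lemma test_function_C1: "u \<in> test_functions \<Omega> \<Longrightarrow> Ck_compact (Suc 0) \<Omega> u"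
  by (simp add: test_functions_iff)

lemma sqrt_pre_form_diff_le_diff:
  assumes "u \<in> test_functions \<Omega>" "v \<in> test_functions \<Omega>" "u' \<in> test_functions \<Omega>" "v' \<in> test_functions \<Omega>"
  shows "sqrt (pre_form \<Omega> c (\<lambda>x. (u x - v x) - (u' x - v' x)))
    \<le> sqrt (pre_form \<Omega> c (\<lambda>x. u x - u' x)) + sqrt (pre_form \<Omega> c (\<lambda>x. v x - v' x))"
proof -
  have eq: "(\<lambda>x. (u x - v x) - (u' x - v' x) - (u x - u' x)) = (\<lambda>x. v' x - v x)" by auto
  show ?thesis
    using sqrt_pre_form_triangle[of "\<lambda>x. (u x - v x) - (u' x - v' x)" "\<lambda>x. u x - u' x"]
      assms[THEN test_function_C1] pre_form_diff_commute[of v v'] by (simp add: Ck_compact_diff eq)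
qed

lemma test_functions_diff:
  "u \<in> test_functions \<Omega> \<Longrightarrow> v \<in> test_functions \<Omega> \<Longrightarrow> (\<lambda>x. u x - v x) \<in> test_functions \<Omega>"
  by (simp add: test_functions_iff Ck_compact_diff)

text \<open>The difference of two approximations of the same \<open>f\<close> tends to
  \<open>0\<close> in L2 and is again Cauchy for the form, so closability applies to it.\<close>

lemma form_approx_pre_form_diff_tendsto_0:
  assumes f: "f \<in> L2_space (lebesgue_on \<Omega>)"
    and u: "form_approx (lebesgue_on \<Omega>) (test_functions \<Omega>) (pre_form \<Omega> c) u f"
    and v: "form_approx (lebesgue_on \<Omega>) (test_functions \<Omega>) (pre_form \<Omega> c) v f"
  shows "(\<lambda>n. pre_form \<Omega> c (\<lambda>x. u n x - v n x)) \<longlonglongrightarrow> 0"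
proof (rule pre_form_tendsto_0)
  let ?M = "lebesgue_on \<Omega>"
  have ut: "\<And>n. u n \<in> test_functions \<Omega>" and vt: "\<And>n. v n \<in> test_functions \<Omega>"
    using u v by (auto simp: form_approx_def)
  show "\<And>n. (\<lambda>x. u n x - v n x) \<in> test_functions \<Omega>" by (intro test_functions_diff ut vt)
  have uL: "\<And>n. u n \<in> L2_space ?M" "\<And>n. v n \<in> L2_space ?M"
    using Ck_compact_L2[OF open_domain test_function_C1] ut vt by auto
  let ?b = "\<lambda>n. 2 * L2_inner ?M (\<lambda>x. u n x - f x) (\<lambda>x. u n x - f x)
      + 2 * L2_inner ?M (\<lambda>x. v n x - f x) (\<lambda>x. v n x - f x)"
  show "(\<lambda>n. L2_inner ?M (\<lambda>x. u n x - v n x) (\<lambda>x. u n x - v n x)) \<longlonglongrightarrow> 0"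
  proof (rule tendsto_sandwich[where f = "\<lambda>n. 0" and h = ?b])
    show "?b \<longlonglongrightarrow> 0"
      using u v by (auto simp: form_approx_def intro!: tendsto_eq_intros)
    have "L2_inner ?M (\<lambda>x. u n x - v n x) (\<lambda>x. u n x - v n x) \<le> ?b n" for n
    proof -
      have i: "integrable ?M (\<lambda>x. (u n x - f x)\<^sup>2)" "integrable ?M (\<lambda>x. (v n x - f x)\<^sup>2)"
        by (intro L2_diff_square_integrable uL f)+
      have "(\<integral>x. (u n x - v n x)\<^sup>2 \<partial>?M) \<le> (\<integral>x. 2 * (u n x - f x)\<^sup>2 + 2 * (v n x - f x)\<^sup>2 \<partial>?M)"
      proof (rule integral_mono)
        show "integrable ?M (\<lambda>x. (u n x - v n x)\<^sup>2)" by (intro L2_diff_square_integrable uL)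
        show "integrable ?M (\<lambda>x. 2 * (u n x - f x)\<^sup>2 + 2 * (v n x - f x)\<^sup>2)" using i by simp
        fix x show "(u n x - v n x)\<^sup>2 \<le> 2 * (u n x - f x)\<^sup>2 + 2 * (v n x - f x)\<^sup>2"
          using zero_le_power2[of "(u n x - f x) + (v n x - f x)"]
          by (simp add: power2_eq_square algebra_simps)
      qed
      then show ?thesis using i by (simp add: L2_inner_def power2_eq_square)
    qed
    then show "\<forall>\<^sub>F n in sequentially. L2_inner ?M (\<lambda>x. u n x - v n x) (\<lambda>x. u n x - v n x) \<le> ?b n"
      by simp
    show "\<forall>\<^sub>F n in sequentially. 0 \<le> L2_inner ?M (\<lambda>x. u n x - v n x) (\<lambda>x. u n x - v n x)"
      by (simp add: L2_inner_def)
  qed simp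
  fix e :: real assume e: "e > 0"
  \<comment> \<open>The triangle inequality lives on the level of square roots, and
    \<open>sqrt (e / 4)\<close> is half of \<open>sqrt e\<close>.\<close>
  then have "e / 4 > 0" by simp
  with u obtain N1 where N1: "\<And>m n. m \<ge> N1 \<Longrightarrow> n \<ge> N1 \<Longrightarrow> pre_form \<Omega> c (\<lambda>x. u m x - u n x) < e / 4"
    unfolding form_approx_def by blast
  from v \<open>e / 4 > 0\<close> obtain N2 where
    N2: "\<And>m n. m \<ge> N2 \<Longrightarrow> n \<ge> N2 \<Longrightarrow> pre_form \<Omega> c (\<lambda>x. v m x - v n x) < e / 4"
    unfolding form_approx_def by blast
  show "\<exists>N. \<forall>m\<ge>N. \<forall>n\<ge>N. pre_form \<Omega> c (\<lambda>x. (u m x - v m x) - (u n x - v n x)) < e"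
  proof (intro exI[of _ "max N1 N2"] allI impI)
    fix m n assume "max N1 N2 \<le> m" "max N1 N2 \<le> n"
    then have "sqrt (pre_form \<Omega> c (\<lambda>x. u m x - u n x)) < sqrt (e / 4)"
      "sqrt (pre_form \<Omega> c (\<lambda>x. v m x - v n x)) < sqrt (e / 4)"
      using N1[of m n] N2[of m n] by auto
    moreover have "sqrt (e / 4) = sqrt e / 2" by (simp add: real_sqrt_divide)
    ultimately have "sqrt (pre_form \<Omega> c (\<lambda>x. (u m x - v m x) - (u n x - v n x))) < sqrt e"
      using sqrt_pre_form_diff_le_diff[OF ut vt ut vt, of m m n n] by linarith
    then show "pre_form \<Omega> c (\<lambda>x. (u m x - v m x) - (u n x - v n x)) < e" by simp
  qed
qed

text \<open>Resolves the description in \<open>closure_form\<close>. The square roots of the form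
  are Cauchy by the triangle inequality, hence converge, and the preceding lemma forces the same
  limit on every other approximation; \<open>u\<close> itself excludes a second value.\<close>

lemma h_form_tendsto:
  assumes f: "f \<in> L2_space (lebesgue_on \<Omega>)"
    and u: "form_approx (lebesgue_on \<Omega>) (test_functions \<Omega>) (pre_form \<Omega> c) u f"
  shows "(\<lambda>n. pre_form \<Omega> c (u n)) \<longlonglongrightarrow> h_form \<Omega> c f"
proof -
  have ut: "\<And>n. u n \<in> test_functions \<Omega>" using u by (auto simp: form_approx_def)
  have "Cauchy (\<lambda>n. sqrt (pre_form \<Omega> c (u n)))"
  proof (rule CauchyI)
    fix e :: real assume "e > 0"
    then have "e\<^sup>2 > 0" by simp
    with u obtain N where N: "\<And>m n. m \<ge> N \<Longrightarrow> n \<ge> N \<Longrightarrow> pre_form \<Omega> c (\<lambda>x. u m x - u n x) < e\<^sup>2"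
      unfolding form_approx_def by blast
    have "norm (sqrt (pre_form \<Omega> c (u m)) - sqrt (pre_form \<Omega> c (u n))) < e" if "m \<ge> N" "n \<ge> N" for m n
      using abs_sqrt_pre_form_diff_le[OF test_function_C1[OF ut] test_function_C1[OF ut], of m n]
        real_less_lsqrt[OF _ N[OF that]] \<open>e > 0\<close> by simp
    then show "\<exists>M. \<forall>m\<ge>M. \<forall>n\<ge>M. norm (sqrt (pre_form \<Omega> c (u m)) - sqrt (pre_form \<Omega> c (u n))) < e" by blast
  qed
  then obtain l where l: "(\<lambda>n. sqrt (pre_form \<Omega> c (u n))) \<longlonglongrightarrow> l"
    using Cauchy_convergent convergent_def by blast
  have lim: "(\<lambda>n. pre_form \<Omega> c (v n)) \<longlonglongrightarrow> l\<^sup>2"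
    if v: "form_approx (lebesgue_on \<Omega>) (test_functions \<Omega>) (pre_form \<Omega> c) v f" for v
  proof -
    have vt: "\<And>n. v n \<in> test_functions \<Omega>" using v by (auto simp: form_approx_def)
    have "(\<lambda>n. sqrt (pre_form \<Omega> c (v n)) - sqrt (pre_form \<Omega> c (u n))) \<longlonglongrightarrow> 0"
    proof (rule Lim_null_comparison)
      show "\<forall>\<^sub>F n in sequentially. norm (sqrt (pre_form \<Omega> c (v n)) - sqrt (pre_form \<Omega> c (u n)))
        \<le> sqrt (pre_form \<Omega> c (\<lambda>x. v n x - u n x))"
        using abs_sqrt_pre_form_diff_le[OF test_function_C1[OF vt] test_function_C1[OF ut]] by simp
      show "(\<lambda>n. sqrt (pre_form \<Omega> c (\<lambda>x. v n x - u n x))) \<longlonglongrightarrow> 0"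
        using tendsto_real_sqrt[OF form_approx_pre_form_diff_tendsto_0[OF f v u]] by simp
    qed
    from tendsto_power[OF tendsto_add[OF this l], of 2] show ?thesis
      by (simp add: pre_form_nonneg)
  qed
  have "h_form \<Omega> c f = l\<^sup>2"
    unfolding h_form_def closure_form_def
  proof (rule the_equality)
    show "\<forall>v. form_approx (lebesgue_on \<Omega>) (test_functions \<Omega>) (pre_form \<Omega> c) v f
      \<longrightarrow> (\<lambda>n. pre_form \<Omega> c (v n)) \<longlonglongrightarrow> l\<^sup>2" using lim by blast
  next
    fix z assume "\<forall>v. form_approx (lebesgue_on \<Omega>) (test_functions \<Omega>) (pre_form \<Omega> c) v f
      \<longrightarrow> (\<lambda>n. pre_form \<Omega> c (v n)) \<longlonglongrightarrow> z"
    then show "z = l\<^sup>2" using u lim[OF u] LIMSEQ_unique by blast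
  qed
  then show ?thesis using lim[OF u] by simp
qed

text \<open>Uses the constant sequence. Optimality can therefore be tested on
  \<open>pre_form\<close> alone.\<close>

lemma test_function_in_h_dom:
  assumes f: "f \<in> test_functions \<Omega>"
  shows "f \<in> h_dom \<Omega> c" and "h_form \<Omega> c f = pre_form \<Omega> c f"
proof -
  have z: "pre_form \<Omega> c (\<lambda>x. 0) = 0"
    by (simp add: pre_form_def L2_inner_def partial_deriv_const)
  have a: "form_approx (lebesgue_on \<Omega>) (test_functions \<Omega>) (pre_form \<Omega> c) (\<lambda>n. f) f"
    using f by (simp add: form_approx_def L2_inner_def z)
  have L: "f \<in> L2_space (lebesgue_on \<Omega>)"
    using Ck_compact_L2[OF open_domain test_function_C1[OF f]] .
  show "f \<in> h_dom \<Omega> c" using a L unfolding h_dom_def closure_dom_def by blast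
  show "h_form \<Omega> c f = pre_form \<Omega> c f"
    using h_form_tendsto[OF L a] by (simp add: LIMSEQ_const_iff)
qed

text \<open>Fatou's lemma along an almost everywhere convergent subsequence.\<close>

lemma weighted_inequality_closure:
  assumes W[measurable]: "W \<in> borel_measurable (lebesgue_on \<Omega>)" and W0: "\<And>x. 0 \<le> W x"
    and test: "\<And>u. u \<in> test_functions \<Omega> \<Longrightarrow> integrable (lebesgue_on \<Omega>) (\<lambda>x. W x * (u x)\<^sup>2) \<and>
      (\<integral>x. W x * (u x)\<^sup>2 \<partial>lebesgue_on \<Omega>) \<le> pre_form \<Omega> c u"
    and f: "f \<in> h_dom \<Omega> c"
  shows "integrable (lebesgue_on \<Omega>) (\<lambda>x. W x * (f x)\<^sup>2)"
    and "(\<integral>x. W x * (f x)\<^sup>2 \<partial>lebesgue_on \<Omega>) \<le> h_form \<Omega> c f"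
proof -
  let ?M = "lebesgue_on \<Omega>"
  obtain u where L: "f \<in> L2_space ?M" and u: "form_approx ?M (test_functions \<Omega>) (pre_form \<Omega> c) u f"
    using f unfolding h_dom_def closure_dom_def by blast
  have ut: "\<And>n. u n \<in> test_functions \<Omega>" using u by (auto simp: form_approx_def)
  have uL: "\<And>n. u n \<in> L2_space ?M" using Ck_compact_L2[OF open_domain test_function_C1[OF ut]] .
  have [measurable]: "f \<in> borel_measurable ?M" "\<And>n. u n \<in> borel_measurable ?M"
    using L uL by (auto simp: L2_space_def)
  have "\<exists>r::nat\<Rightarrow>nat. strict_mono r \<and> (AE x in ?M. (\<lambda>n. (u (r n) x - f x)\<^sup>2) \<longlonglongrightarrow> 0)"
  proof (rule tendsto_L1_AE_subseq)
    show "\<And>n. integrable ?M (\<lambda>x. (u n x - f x)\<^sup>2)" by (intro L2_diff_square_integrable uL L)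
    show "(\<lambda>n. \<integral>x. norm ((u n x - f x)\<^sup>2) \<partial>?M) \<longlonglongrightarrow> 0"
      using u by (simp add: form_approx_def L2_inner_def power2_eq_square)
  qed
  then obtain r :: "nat \<Rightarrow> nat" where r: "strict_mono r"
    and ae: "AE x in ?M. (\<lambda>n. (u (r n) x - f x)\<^sup>2) \<longlonglongrightarrow> 0" by blast
  have lim: "(\<lambda>n. pre_form \<Omega> c (u (r n))) \<longlonglongrightarrow> h_form \<Omega> c f"
    using LIMSEQ_subseq_LIMSEQ[OF h_form_tendsto[OF L u] r] by (simp add: o_def)
  then have h0: "0 \<le> h_form \<Omega> c f" by (rule LIMSEQ_le_const) (simp add: pre_form_nonneg)
  have "AE x in ?M. ennreal (W x * (f x)\<^sup>2) = liminf (\<lambda>n. ennreal (W x * (u (r n) x)\<^sup>2))"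
    using ae
  proof eventually_elim
    case (elim x)
    then have "(\<lambda>n. u (r n) x - f x) \<longlonglongrightarrow> 0" by simp
    then have "(\<lambda>n. u (r n) x) \<longlonglongrightarrow> f x" by (rule LIM_zero_cancel)
    then have "(\<lambda>n. ennreal (W x * (u (r n) x)\<^sup>2)) \<longlonglongrightarrow> ennreal (W x * (f x)\<^sup>2)"
      by (intro tendsto_ennrealI tendsto_intros)
    then show ?case by (simp add: lim_imp_Liminf)
  qed
  then have "(\<integral>\<^sup>+x. ennreal (W x * (f x)\<^sup>2) \<partial>?M) = (\<integral>\<^sup>+x. liminf (\<lambda>n. ennreal (W x * (u (r n) x)\<^sup>2)) \<partial>?M)"
    by (rule nn_integral_cong_AE)
  also have "\<dots> \<le> liminf (\<lambda>n. \<integral>\<^sup>+x. ennreal (W x * (u (r n) x)\<^sup>2) \<partial>?M)"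
    by (rule nn_integral_liminf) measurable
  also have "\<dots> \<le> liminf (\<lambda>n. ennreal (pre_form \<Omega> c (u (r n))))"
  proof (rule Liminf_mono, rule always_eventually, rule allI)
    fix n
    show "(\<integral>\<^sup>+x. ennreal (W x * (u (r n) x)\<^sup>2) \<partial>?M) \<le> ennreal (pre_form \<Omega> c (u (r n)))"
      using test[OF ut, of "r n"] W0 by (subst nn_integral_eq_integral) (auto intro: ennreal_leI)
  qed
  also have "\<dots> = ennreal (h_form \<Omega> c f)"
    using lim by (intro lim_imp_Liminf tendsto_ennrealI) auto
  \<comment> \<open>The bound is a finite number, so it yields integrability as well as the
    inequality; the former is part of \<open>hardy_inequality\<close>.\<close>
  finally have le: "(\<integral>\<^sup>+x. ennreal (W x * (f x)\<^sup>2) \<partial>?M) \<le> ennreal (h_form \<Omega> c f)" .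
  show i: "integrable ?M (\<lambda>x. W x * (f x)\<^sup>2)"
  proof (rule integrableI_nonneg)
    show "(\<integral>\<^sup>+x. ennreal (W x * (f x)\<^sup>2) \<partial>?M) < \<infinity>"
      using le by (simp add: le_less_trans)
  qed (use W0 in auto)
  show "(\<integral>x. W x * (f x)\<^sup>2 \<partial>?M) \<le> h_form \<Omega> c f"
    using le nn_integral_eq_integral[OF i] W0 h0 by simp
qed

end

section \<open>The Hardy inequality\<close>

lemma degeneracy_coeff_nonneg: "0 \<le> degeneracy_coeff \<delta> \<delta>' s"
  by (simp add: degeneracy_coeff_def)

text \<open>The logarithmic derivative \<open>s c'(s) / c(s)\<close> of the coefficient, which runs
  from \<delta> near \<open>0\<close> to \<delta>' near infinity.\<close>

definition log_slope :: "real \<Rightarrow> real \<Rightarrow> real \<Rightarrow> real" where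
  "log_slope \<delta> \<delta>' s = \<delta> + (\<delta>' - \<delta>) * (s / (1 + s))"

text \<open>The slope is a convex combination of the two exponents with weight
  \<open>s / (1 + s)\<close> on \<delta>'.\<close>

lemma min_le_log_slope:
  assumes "s > 0" shows "min \<delta> \<delta>' \<le> log_slope \<delta> \<delta>' s"
proof -
  define p where "p = s / (1 + s)"
  have p: "0 \<le> p" "p \<le> 1" using assms by (auto simp: p_def)
  have "min \<delta> \<delta>' = min \<delta> \<delta>' * (1 - p) + min \<delta> \<delta>' * p" by (simp add: algebra_simps)
  also have "\<dots> \<le> \<delta> * (1 - p) + \<delta>' * p"
    using p by (intro add_mono mult_right_mono) auto
  also have "\<dots> = log_slope \<delta> \<delta>' s" by (simp add: log_slope_def p_def[symmetric] algebra_simps)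
  finally show ?thesis .
qed

lemma DERIV_degeneracy_coeff:
  assumes "s > 0"
  shows "(degeneracy_coeff \<delta> \<delta>' has_real_derivative
    degeneracy_coeff \<delta> \<delta>' s / s * log_slope \<delta> \<delta>' s) (at s)"
proof -
  have d: "((\<lambda>s. s powr \<delta> * (1 + s) powr (\<delta>' - \<delta>)) has_real_derivative
    (\<delta> * s powr (\<delta> - 1)) * (1 + s) powr (\<delta>' - \<delta>)
      + s powr \<delta> * ((\<delta>' - \<delta>) * (1 + s) powr (\<delta>' - \<delta> - 1))) (at s)"
    using assms by (auto intro!: derivative_eq_intros)
  have gen: "\<delta> * (A / s) * B + A * (e * (B / (1 + s))) = A * B / s * (\<delta> + e * (s / (1 + s)))" for A B e
    using assms by (simp add: distrib_left mult_ac)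
  have "s powr (\<delta> - 1) = s powr \<delta> / s" "(1 + s) powr (\<delta>' - \<delta> - 1) = (1 + s) powr (\<delta>' - \<delta>) / (1 + s)"
    using assms by (simp_all add: powr_diff del: diff_diff_eq)
  then have "(\<delta> * s powr (\<delta> - 1)) * (1 + s) powr (\<delta>' - \<delta>)
      + s powr \<delta> * ((\<delta>' - \<delta>) * (1 + s) powr (\<delta>' - \<delta> - 1))
    = degeneracy_coeff \<delta> \<delta>' s / s * log_slope \<delta> \<delta>' s"
    unfolding degeneracy_coeff_def log_slope_def by (simp only: gen)
  with d show ?thesis unfolding degeneracy_coeff_def[abs_def] by simp
qed

lemma partial_deriv_radial:
  fixes x :: "real^'n::finite"
  assumes "(g has_real_derivative d) (at (norm x))" "x \<noteq> 0"
  shows "(\<lambda>x::real^'n. g (norm x)) differentiable at x"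
    and "partial_deriv k (\<lambda>x. g (norm x)) x = d * (x $ k / norm x)"
proof -
  have n: "(norm has_derivative (\<lambda>h. h \<bullet> sgn x)) (at x)"
    using has_derivative_norm[OF assms(2)] by simp
  then have "norm differentiable at x" by (rule differentiableI)
  from chain_real_at[OF assms(1) this] show "(\<lambda>x::real^'n. g (norm x)) differentiable at x"
    "partial_deriv k (\<lambda>x. g (norm x)) x = d * (x $ k / norm x)"
    using partial_deriv_eq[OF n] by (auto simp: inner_axis' sgn_div_norm divide_inverse mult_ac)
qed

lemma Ck_on_radial:
  assumes "\<And>s. s > 0 \<Longrightarrow> (g has_real_derivative g' s) (at s)" "continuous_on {0<..} g'"
  shows "Ck_on (Suc 0) (UNIV - {0}) (\<lambda>x::real^'n::finite. g (norm x))"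
proof -
  have o: "open (UNIV - {0 :: real^'n})" by (simp add: open_Diff)
  have c: "continuous_on (UNIV - {0 :: real^'n}) (\<lambda>x. g' (norm x))"
    by (rule continuous_on_compose2[OF assms(2) continuous_on_norm_id]) auto
  have "continuous_on (UNIV - {0}) (\<lambda>x::real^'n. x $ k / norm x)" for k
    by (rule continuous_on_divide[OF continuous_on_component[OF continuous_on_id] continuous_on_norm_id]) simp
  from continuous_on_mult[OF c this]
  have d: "continuous_on (UNIV - {0}) (\<lambda>x::real^'n. g' (norm x) * (x $ k / norm x))" for k .
  have "Ck_on 0 (UNIV - {0}) (partial_deriv k (\<lambda>x::real^'n. g (norm x)))" for k
  proof (rule Ck_on_cong[OF o])
    show "Ck_on 0 (UNIV - {0}) (\<lambda>x::real^'n. g' (norm x) * (x $ k / norm x))" using d by simp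
    fix x :: "real^'n" assume "x \<in> UNIV - {0}"
    then show "g' (norm x) * (x $ k / norm x) = partial_deriv k (\<lambda>x. g (norm x)) x"
      using partial_deriv_radial(2)[OF assms(1), of x k] by simp
  qed
  moreover have "(\<lambda>x::real^'n. g (norm x)) differentiable at x" if "x \<noteq> 0" for x
    using partial_deriv_radial(1)[OF assms(1)] that by simp
  ultimately show ?thesis by simp
qed

lemma continuous_on_degeneracy_coeff: "continuous_on {0<..} (degeneracy_coeff \<delta> \<delta>')"
  by (auto intro!: continuous_at_imp_continuous_on DERIV_isCont DERIV_degeneracy_coeff)

lemma Ck_on_degeneracy_coeff:
  "Ck_on (Suc 0) (UNIV - {0}) (\<lambda>x::real^'n::finite. degeneracy_coeff \<delta> \<delta>' (norm x))"
proof (rule Ck_on_radial[OF DERIV_degeneracy_coeff])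
  show "continuous_on {0<..} (\<lambda>s. degeneracy_coeff \<delta> \<delta>' s / s * log_slope \<delta> \<delta>' s)"
    unfolding log_slope_def
    by (intro continuous_intros continuous_on_degeneracy_coeff) (auto simp: add_nonneg_eq_0_iff)
qed

lemma borel_measurable_degeneracy_coeff:
  "(\<lambda>x::real^'n::finite. degeneracy_coeff \<delta> \<delta>' (norm x)) \<in> borel_measurable borel"
  unfolding degeneracy_coeff_def by measurable

text \<open>Lowering both exponents by \<open>2\<close> keeps their difference, so the Hardy weight
  belongs to the same family and inherits its calculus. At \<open>s = 0\<close> both sides are
  \<open>0\<close> by the conventions for \<open>inverse\<close> and \<open>powr\<close>.\<close>

lemma degeneracy_coeff_over_square:
  "degeneracy_coeff \<delta> \<delta>' s * (inverse s)\<^sup>2 = degeneracy_coeff (\<delta> - 2) (\<delta>' - 2) s" if "s \<ge> 0"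
proof (cases "s = 0")
  case False
  then have "s powr (\<delta> - 2) = s powr \<delta> * (inverse s)\<^sup>2"
    using that by (simp add: powr_diff divide_inverse power_inverse)
  then show ?thesis by (simp add: degeneracy_coeff_def)
qed (simp add: degeneracy_coeff_def)

lemma sum_nth_square: "(\<Sum>k\<in>UNIV. (x $ k)\<^sup>2) = (norm x)\<^sup>2" for x :: "real^'n::finite"
  unfolding power2_norm_eq_inner by (simp add: inner_vec_def power2_eq_square)

locale punctured_hardy =
  fixes \<delta> \<delta>' :: real and \<Omega> :: "(real^'n::finite) set"
    and c W :: "real^'n \<Rightarrow> real" and D :: real
  assumes domain_eq: "\<Omega> = UNIV - {0}"
    and coeff_eq: "c = (\<lambda>x. degeneracy_coeff \<delta> \<delta>' (norm x))"
    and weight_eq: "W = (\<lambda>x. degeneracy_coeff (\<delta> - 2) (\<delta>' - 2) (norm x))"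
    and dim_eq: "D = real CARD('n) + min \<delta> \<delta>' - 2"
begin

lemma open_punctured: "open \<Omega>"
  unfolding domain_eq by (simp add: open_Diff)

lemma weighted_form_punctured: "weighted_form \<Omega> c"
  using Ck_on_degeneracy_coeff open_punctured
  by unfold_locales (auto simp: domain_eq coeff_eq degeneracy_coeff_nonneg simp del: Ck_on.simps)

sublocale weighted_form \<Omega> c by (rule weighted_form_punctured)

lemma coeff_over_square: "c x * (inverse (norm x))\<^sup>2 = W x"
  unfolding coeff_eq weight_eq by (simp add: degeneracy_coeff_over_square)

lemma weight_nonneg: "0 \<le> W x"
  unfolding weight_eq by (rule degeneracy_coeff_nonneg)

lemma Ck_on_weight: "Ck_on (Suc 0) \<Omega> W"
  unfolding domain_eq weight_eq by (rule Ck_on_degeneracy_coeff)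

text \<open>The coordinates contribute \<open>W\<close> once per dimension. The derivative of
  \<open>W\<close> is radial and contributes \<open>r W'(r)\<close>, that is \<open>W\<close> times
  its own logarithmic slope, which is the slope of \<open>c\<close> minus \<open>2\<close>.\<close>

lemma partial_deriv_hardy_field:
  assumes "x \<in> \<Omega>"
  shows "(\<Sum>k\<in>UNIV. partial_deriv k (\<lambda>x. x $ k * W x) x)
    = W x * (real CARD('n) + log_slope \<delta> \<delta>' (norm x) - 2)"
proof -
  have x: "x \<noteq> 0" using assms by (simp add: domain_eq)
  have ls: "log_slope (\<delta> - 2) (\<delta>' - 2) s = log_slope \<delta> \<delta>' s - 2" for s
    by (simp add: log_slope_def)
  have dW: "partial_deriv k W x = W x / norm x * (log_slope \<delta> \<delta>' (norm x) - 2) * (x $ k / norm x)" for k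
    using partial_deriv_radial(2)[OF DERIV_degeneracy_coeff[of "norm x" "\<delta> - 2" "\<delta>' - 2"] x] x
    by (simp add: weight_eq ls)
  have "W differentiable at x" using Ck_on_weight assms by simp
  moreover have "(\<lambda>x. x $ k) differentiable at x" for k
    by (intro bounded_linear_imp_differentiable bounded_linear_vec_nth)
  ultimately have "partial_deriv k (\<lambda>x. x $ k * W x) x
     = W x + W x * (log_slope \<delta> \<delta>' (norm x) - 2) / (norm x)\<^sup>2 * (x $ k)\<^sup>2" for k
    by (subst partial_deriv_mult) (simp_all add: partial_deriv_nth dW power2_eq_square)
  then have "(\<Sum>k\<in>UNIV. partial_deriv k (\<lambda>x. x $ k * W x) x)
    = (\<Sum>k\<in>(UNIV::'n set). W x) + W x * (log_slope \<delta> \<delta>' (norm x) - 2) / (norm x)\<^sup>2 * (\<Sum>k\<in>UNIV. (x $ k)\<^sup>2)"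
    by (simp only: sum.distrib sum_distrib_left)
  also have "\<dots> = real CARD('n) * W x + W x * (log_slope \<delta> \<delta>' (norm x) - 2)"
    using x by (simp add: sum_nth_square)
  finally show ?thesis by (simp add: algebra_simps)
qed

lemma integrable_weight_test:
  assumes "u \<in> test_functions \<Omega>" shows "integrable (lebesgue_on \<Omega>) (\<lambda>x. W x * (u x)\<^sup>2)"
  unfolding power2_eq_square
  by (intro Ck_compact_integrable[OF open_punctured, of 0] Ck_compact_mult[OF _ open_punctured]
      Ck_compact_mult'[OF open_punctured] Ck_compact_SucD[OF test_function_C1[OF assms]] Ck_on_SucD[OF Ck_on_weight])

text \<open>Integrate the square of \<open>grad u + (D/2) u x/|x|\<^sup>2\<close> against \<open>c\<close>; the cross term is
  handled by the divergence theorem for the field \<open>u\<^sup>2 W x\<close>.\<close>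

lemma hardy_test_functions:
  assumes u: "u \<in> test_functions \<Omega>" and D: "D \<ge> 0"
  shows "D\<^sup>2 / 4 * (\<integral>x. W x * (u x)\<^sup>2 \<partial>lebesgue_on \<Omega>) \<le> pre_form \<Omega> c u"
proof -
  let ?M = "lebesgue_on \<Omega>"
  define X where "X k x = x $ k * W x" for k x
  define Z where "Z x = (\<Sum>k\<in>UNIV. partial_deriv k (\<lambda>x. X k x * (u x * u x)) x)" for x
  note u1 = test_function_C1[OF u]
  have X: "Ck_on (Suc 0) \<Omega> (X k)" for k
    unfolding X_def by (intro Ck_on_mult open_punctured Ck_on_nth Ck_on_weight)
  have uX: "Ck_compact (Suc 0) \<Omega> (\<lambda>x. X k x * (u x * u x))" for k
    by (intro Ck_compact_mult[OF _ open_punctured X] Ck_compact_mult'[OF open_punctured] u1)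
  have iZ: "integrable ?M Z"
    unfolding Z_def by (intro Bochner_Integration.integrable_sum
        Ck_compact_integrable[OF open_punctured Ck_compact_partial_deriv[OF uX]])
  have Z0: "(\<integral>x. Z x \<partial>?M) = 0"
    unfolding Z_def
    by (subst Bochner_Integration.integral_sum)
      (auto intro: Ck_compact_integrable[OF open_punctured Ck_compact_partial_deriv[OF uX]]
        simp: integral_lebesgue_on_partial_deriv_eq_0[OF open_punctured uX])
  define E where "E x = (\<Sum>k\<in>UNIV. partial_deriv k u x * (c x * partial_deriv k u x))" for x
  have iE: "integrable ?M E"
    unfolding E_def by (intro Bochner_Integration.integrable_sum integrable_energy u1)
  have E: "(\<integral>x. E x \<partial>?M) = pre_form \<Omega> c u"
    unfolding E_def pre_form_def L2_inner_def
    by (intro Bochner_Integration.integral_sum integrable_energy u1)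
  have "(\<integral>x. D\<^sup>2 / 4 * (W x * (u x)\<^sup>2) \<partial>?M) \<le> (\<integral>x. E x + D / 2 * Z x \<partial>?M)"
  proof (rule integral_mono)
    show "integrable ?M (\<lambda>x. D\<^sup>2 / 4 * (W x * (u x)\<^sup>2))"
      by (intro integrable_mult_right integrable_weight_test u)
    show "integrable ?M (\<lambda>x. E x + D / 2 * Z x)"
      by (intro Bochner_Integration.integrable_add integrable_mult_right iE iZ)
    fix x assume "x \<in> space ?M"
    then have x: "x \<in> \<Omega>" "x \<noteq> 0" by (auto simp: domain_eq)
    define S where "S = (\<Sum>k\<in>UNIV. x $ k * partial_deriv k u x)"
    define L where "L = log_slope \<delta> \<delta>' (norm x)"
    have du: "u differentiable at x" by (rule Ck_compact_differentiable[OF u1])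
    have dX: "X k differentiable at x" for k using X x by simp
    have "partial_deriv k (\<lambda>x. X k x * (u x * u x)) x
      = (u x)\<^sup>2 * partial_deriv k (X k) x + 2 * u x * W x * (x $ k * partial_deriv k u x)" for k
      using du dX by (simp add: partial_deriv_mult X_def[of k x] power2_eq_square algebra_simps)
    then have "Z x = (u x)\<^sup>2 * (\<Sum>k\<in>UNIV. partial_deriv k (X k) x) + 2 * u x * W x * S"
      unfolding Z_def S_def by (simp only: sum.distrib sum_distrib_left)
    then have Z: "Z x = (u x)\<^sup>2 * W x * (real CARD('n) + L - 2) + 2 * u x * W x * S"
      using partial_deriv_hardy_field[OF x(1)] by (simp add: X_def[abs_def] L_def)
    have cW: "c x = W x * (norm x)\<^sup>2"
      using x by (simp add: coeff_over_square[symmetric] power_inverse)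
    have "0 \<le> (\<Sum>k\<in>UNIV. c x * (partial_deriv k u x + D / 2 * u x / (norm x)\<^sup>2 * x $ k)\<^sup>2)"
      by (intro sum_nonneg mult_nonneg_nonneg coeff_nonneg) simp
    also have "\<dots> = (\<Sum>k\<in>UNIV. partial_deriv k u x * (c x * partial_deriv k u x)
      + D * u x * W x * (x $ k * partial_deriv k u x)
      + (D / 2 * u x)\<^sup>2 * W x / (norm x)\<^sup>2 * (x $ k)\<^sup>2)"
      using x unfolding cW by (intro sum.cong refl) (simp add: field_simps power2_eq_square)
    also have "\<dots> = E x + D * u x * W x * S
      + (D / 2 * u x)\<^sup>2 * W x / (norm x)\<^sup>2 * (\<Sum>k\<in>UNIV. (x $ k)\<^sup>2)"
      unfolding E_def S_def by (simp only: sum.distrib sum_distrib_left)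
    also have "\<dots> = E x + D * u x * W x * S + D\<^sup>2 / 4 * (W x * (u x)\<^sup>2)"
      unfolding sum_nth_square using x by (simp add: power2_eq_square)
    finally have sq: "0 \<le> E x + D * u x * W x * S + D\<^sup>2 / 4 * (W x * (u x)\<^sup>2)" .
    \<comment> \<open>The only place where the minimum of the exponents enters the inequality. With
      \<open>D \<ge> 0\<close> the divergence term then gives at least \<open>D\<^sup>2 / 2\<close>
      times \<open>W u\<^sup>2\<close>; the completed square uses up half of this, which leaves
      \<open>D\<^sup>2 / 4\<close>.\<close>
    have "D \<le> real CARD('n) + L - 2"
      using min_le_log_slope[of "norm x" \<delta> \<delta>'] x by (simp add: dim_eq L_def)
    then have "D / 2 * ((u x)\<^sup>2 * W x * D) \<le> D / 2 * ((u x)\<^sup>2 * W x * (real CARD('n) + L - 2))"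
      using D weight_nonneg by (intro mult_left_mono mult_nonneg_nonneg) auto
    moreover have "D / 2 * Z x = D / 2 * ((u x)\<^sup>2 * W x * (real CARD('n) + L - 2)) + D * u x * W x * S"
      unfolding Z by (simp add: algebra_simps)
    moreover have "D / 2 * ((u x)\<^sup>2 * W x * D) = 2 * (D\<^sup>2 / 4 * (W x * (u x)\<^sup>2))"
      by (simp add: power2_eq_square)
    ultimately show "D\<^sup>2 / 4 * (W x * (u x)\<^sup>2) \<le> E x + D / 2 * Z x"
      using sq by linarith
  qed
  also have "\<dots> = pre_form \<Omega> c u"
    using iE iZ by (simp add: E Z0)
  finally show ?thesis by simp
qed

text \<open>Holds at the origin too, where both sides are zero, so integrands can be rewritten
  without a side condition.\<close>

lemma hardy_function_square:
  "(sqrt (c x) * inverse (bdry_dist \<Omega> x) * f x)\<^sup>2 = W x * (f x)\<^sup>2"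
  by (simp add: coeff_over_square[symmetric] bdry_dist_punctured domain_eq power_mult_distrib
      coeff_eq degeneracy_coeff_nonneg)

lemma hardy_inequality_punctured:
  assumes D: "D > 0" shows "hardy_inequality \<Omega> c (D\<^sup>2 / 4)"
  unfolding hardy_inequality_def Let_def
proof
  let ?M = "lebesgue_on \<Omega>"
  fix f assume f: "f \<in> h_dom \<Omega> c"
  let ?g = "\<lambda>x. sqrt (c x) * inverse (bdry_dist \<Omega> x) * f x"
  have f': "f \<in> borel_measurable ?M"
    using f by (auto simp: h_dom_def closure_dom_def L2_space_def)
  have [measurable]: "W \<in> borel_measurable ?M" "c \<in> borel_measurable ?M"
    "(\<lambda>x. inverse (norm x)) \<in> borel_measurable ?M"
    unfolding weight_eq coeff_eq
    by (auto intro!: measurable_restrict_space1 measurable_completion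
        borel_measurable_degeneracy_coeff)
  have i: "integrable ?M (\<lambda>x. D\<^sup>2 / 4 * W x * (f x)\<^sup>2)"
    and le: "(\<integral>x. D\<^sup>2 / 4 * W x * (f x)\<^sup>2 \<partial>?M) \<le> h_form \<Omega> c f"
    using weighted_inequality_closure[of "\<lambda>x. D\<^sup>2 / 4 * W x" f] f weight_nonneg
      hardy_test_functions integrable_weight_test D by (simp_all add: mult.assoc)
  have iW: "integrable ?M (\<lambda>x. W x * (f x)\<^sup>2)"
    using integrable_mult_right[OF i, of "4 / D\<^sup>2"] D by simp
  have bd: "bdry_dist \<Omega> = norm" by (auto simp: domain_eq bdry_dist_punctured)
  have "?g \<in> borel_measurable ?M"
    using f' unfolding bd by measurable
  then have "?g \<in> L2_space ?M" using iW by (simp only: L2_space_def mem_Collect_eq hardy_function_square)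
  moreover have "L2_inner ?M ?g ?g = (\<integral>x. W x * (f x)\<^sup>2 \<partial>?M)"
    unfolding L2_inner_def power2_eq_square[symmetric] hardy_function_square ..
  moreover have "(\<integral>x. D\<^sup>2 / 4 * W x * (f x)\<^sup>2 \<partial>?M) = D\<^sup>2 / 4 * (\<integral>x. W x * (f x)\<^sup>2 \<partial>?M)"
    by (simp add: mult.assoc)
  ultimately show "?g \<in> L2_space ?M \<and> D\<^sup>2 / 4 * L2_inner ?M ?g ?g \<le> h_form \<Omega> c f"
    using le by simp
qed

end

section \<open>Annuli and the logarithmic cutoff\<close>

lemma integral_lborel_scale:
  fixes f :: "'a::euclidean_space \<Rightarrow> real"
  assumes "t > 0" "f \<in> borel_measurable borel"
  shows "(\<integral>x. f x \<partial>lborel) = t ^ DIM('a) * (\<integral>x. f (t *\<^sub>R x) \<partial>lborel)"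
proof -
  have "(\<integral>x. f x \<partial>lborel) = (\<integral>x. f x \<partial>density (distr lborel borel (\<lambda>x. 0 + t *\<^sub>R x)) (\<lambda>_. ennreal (\<bar>t\<bar> ^ DIM('a))))"
    using lborel_affine[of t "0::'a"] assms(1) by simp
  also have "\<dots> = (\<integral>x. \<bar>t\<bar> ^ DIM('a) *\<^sub>R f x \<partial>distr lborel borel (\<lambda>x. 0 + t *\<^sub>R x))"
    by (rule integral_density) (use assms in auto)
  also have "\<dots> = (\<integral>x. \<bar>t\<bar> ^ DIM('a) *\<^sub>R f (0 + t *\<^sub>R x) \<partial>lborel)"
    by (rule integral_distr) (use assms in auto)
  finally show ?thesis using assms(1) by simp
qed

text \<open>The density of the dilation-invariant measure on the punctured space, cut off to a
  closed annulus.\<close>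

definition annulus_density :: "real \<Rightarrow> real \<Rightarrow> real^'n::finite \<Rightarrow> real" where
  "annulus_density p q x = indicator {x. p \<le> norm x \<and> norm x \<le> q} x * inverse (norm x ^ CARD('n))"

text \<open>For \<open>0 < p \<le> q\<close> this is the area of the unit sphere times
  \<open>ln (q / p)\<close>. That formula is replaced below by scale invariance, positivity and
  subadditivity. The type argument carries the dimension.\<close>

definition annulus_mass :: "'n::finite itself \<Rightarrow> real \<Rightarrow> real \<Rightarrow> real" where
  "annulus_mass TYPE('n) p q = (\<integral>x. annulus_density p q (x :: real^'n) \<partial>lborel)"

lemma annulus_density_nonneg: "0 \<le> annulus_density p q x"
  by (simp add: annulus_density_def)

lemma annulus_density_measurable[measurable]:
  "annulus_density p q \<in> borel_measurable (borel :: (real^'n::finite) measure)"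
  unfolding annulus_density_def[abs_def] by measurable

lemma annulus_density_integrable:
  assumes "p > 0" shows "integrable lborel (annulus_density p q :: real^'n::finite \<Rightarrow> real)"
proof (rule Bochner_Integration.integrable_bound[OF integrable_cball_const[of "inverse (p ^ CARD('n))" q]])
  show "annulus_density p q \<in> borel_measurable (lborel :: (real^'n) measure)" by simp
  have "norm (annulus_density p q x) \<le> norm (inverse (p ^ CARD('n)) * indicator (cball 0 q) x)"
    for x :: "real^'n"
  proof (cases "p \<le> norm x \<and> norm x \<le> q")
    case True
    then have "inverse (norm x ^ CARD('n)) \<le> inverse (p ^ CARD('n))"
      using assms by (intro le_imp_inverse_le power_mono) auto
    then show ?thesis using True assms by (simp add: annulus_density_def)
  next
    case False
    then show ?thesis by (auto simp: annulus_density_def)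
  qed
  then show "AE x in lborel. norm (annulus_density p q x) \<le> norm (inverse (p ^ CARD('n)) * indicator (cball (0::real^'n) q) x)"
    by simp
qed

text \<open>The Jacobian \<open>t ^ CARD('n)\<close> of the dilation cancels the homogeneity of the
  density.\<close>

lemma annulus_mass_scale:
  assumes "t > 0" shows "annulus_mass TYPE('n::finite) (t * p) (t * q) = annulus_mass TYPE('n) p q"
proof -
  have "annulus_density (t * p) (t * q) (t *\<^sub>R x) = inverse (t ^ CARD('n)) * annulus_density p q x"
    for x :: "real^'n"
    using assms by (simp add: annulus_density_def power_mult_distrib indicator_def)
  then show ?thesis
    using assms integral_lborel_scale[OF assms, of "annulus_density (t * p) (t * q) :: real^'n \<Rightarrow> real"]
    by (simp add: annulus_mass_def)
qed

text \<open>A vanishing integral would make the open shell a null set, although it is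
  nonempty.\<close>

lemma annulus_mass_pos:
  assumes "0 < p" "p < q" shows "annulus_mass TYPE('n::finite) p q > 0"
proof -
  let ?S = "{x :: real^'n. p < norm x \<and> norm x < q}"
  have "annulus_mass TYPE('n) p q \<noteq> 0"
  proof
    assume "annulus_mass TYPE('n) p q = 0"
    then have "AE x :: real^'n in lborel. annulus_density p q x = 0"
      using integral_nonneg_eq_0_iff_AE[OF annulus_density_integrable[where 'n = 'n, OF assms(1), of q]]
      by (simp add: annulus_mass_def annulus_density_nonneg)
    then have "AE x in lborel. x \<notin> ?S"
    proof eventually_elim
      case (elim x)
      then show ?case using assms by (auto simp: annulus_density_def)
    qed
    moreover have o: "open ?S" by (intro open_Collect_conj open_Collect_less continuous_intros)
    ultimately have "?S \<in> null_sets lborel"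
      by (subst (asm) AE_iff_null) auto
    then have "negligible ?S"
      by (simp add: negligible_iff_null_sets null_sets_completionI)
    moreover have "?S \<noteq> {}"
    proof -
      have "((p + q) / 2) *\<^sub>R (axis undefined 1 :: real^'n) \<in> ?S" using assms by simp
      then show ?thesis by blast
    qed
    ultimately show False using open_not_negligible[OF o] by blast
  qed
  moreover have "annulus_mass TYPE('n) p q \<ge> 0"
    unfolding annulus_mass_def by (simp add: annulus_density_nonneg)
  ultimately show ?thesis by simp
qed

lemma annulus_mass_subadditive:
  assumes "0 < p" "p \<le> q" "q \<le> r"
  shows "annulus_mass TYPE('n::finite) p r \<le> annulus_mass TYPE('n) p q + annulus_mass TYPE('n) q r"
proof -
  have i: "integrable lborel (annulus_density p q :: real^'n \<Rightarrow> real)"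
    "integrable lborel (annulus_density q r :: real^'n \<Rightarrow> real)"
    "integrable lborel (annulus_density p r :: real^'n \<Rightarrow> real)"
    using assms by (auto intro: annulus_density_integrable)
  have "annulus_density p r x \<le> annulus_density p q x + annulus_density q r x" for x :: "real^'n"
    unfolding annulus_density_def by (auto simp: indicator_def)
  then have "(\<integral>x. annulus_density p r (x :: real^'n) \<partial>lborel)
    \<le> (\<integral>x. annulus_density p q (x :: real^'n) + annulus_density q r x \<partial>lborel)"
    using i by (intro integral_mono) auto
  also have "\<dots> = annulus_mass TYPE('n) p q + annulus_mass TYPE('n) q r"
    unfolding annulus_mass_def using i by (intro Bochner_Integration.integral_add)
  finally show ?thesis by (simp add: annulus_mass_def)
qed

text \<open>The large annulus splits into three consecutive ones, each the dilate by
  \<open>r\<close> of its predecessor. All have the mass of the middle one.\<close>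

lemma annulus_mass_cube_le:
  assumes "0 < p" "1 < r"
  shows "annulus_mass TYPE('n::finite) p (p * r ^ 3) \<le> 3 * annulus_mass TYPE('n) (p * r) (p * r ^ 2)"
proof -
  let ?m = "annulus_mass TYPE('n)"
  have "1 \<le> r ^ 2" using assms by simp
  then have "p \<le> p * r" "p * r \<le> p * r ^ 2" "p * r ^ 2 \<le> p * r ^ 3" "p \<le> p * r ^ 2"
    using assms by (auto simp: power2_eq_square power3_eq_cube)
  then have "?m p (p * r ^ 3) \<le> ?m p (p * r) + ?m (p * r) (p * r ^ 2) + ?m (p * r ^ 2) (p * r ^ 3)"
    using annulus_mass_subadditive[of p "p * r" "p * r ^ 2", where 'n = 'n]
      annulus_mass_subadditive[of p "p * r ^ 2" "p * r ^ 3", where 'n = 'n] assms by simp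
  moreover have "?m (p * r) (p * r ^ 2) = ?m p (p * r)" "?m (p * r ^ 2) (p * r ^ 3) = ?m p (p * r)"
    using annulus_mass_scale[of r p "p * r", where 'n = 'n]
      annulus_mass_scale[of "r ^ 2" p "p * r", where 'n = 'n] assms
    by (simp_all add: power2_eq_square power3_eq_cube mult_ac)
  ultimately show ?thesis by simp
qed

section \<open>A smooth bump in the logarithmic variable\<close>

lemma flat_exp_nonneg: "0 \<le> flat_exp j t"
  by (simp add: flat_exp_def)

lemma flat_exp_0_le_1: "flat_exp 0 t \<le> 1"
  by (simp add: flat_exp_def)

lemma flat_exp_2_le_2: "flat_exp 2 t \<le> 2"
proof (cases "t > 0")
  case True
  define y where "y = 1 / t"
  have y: "y > 0" using True by (simp add: y_def)
  have "y\<^sup>2 \<le> 2 * exp y"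
    using exp_lower_Taylor_quadratic[of y] y by simp
  then have "y\<^sup>2 * exp (- y) \<le> 2"
    by (simp add: exp_minus field_simps)
  then show ?thesis using True by (simp add: flat_exp_def y_def power_divide)
qed (simp add: flat_exp_def)

lemma flat_exp_0_ge: "t \<ge> 1 \<Longrightarrow> exp (- 1) \<le> flat_exp 0 t"
  by (simp add: flat_exp_def)

text \<open>Supported in \<open>{0..3}\<close> and bounded below on \<open>{1..2}\<close>: three
  unit intervals, matching the three congruent annuli of
  \<open>annulus_mass_cube_le\<close>.\<close>

definition log_bump :: "real \<Rightarrow> real" where
  "log_bump t = flat_exp 0 t * flat_exp 0 (3 - t)"

definition log_bump' :: "real \<Rightarrow> real" where
  "log_bump' t = flat_exp 2 t * flat_exp 0 (3 - t) - flat_exp 0 t * flat_exp 2 (3 - t)"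

lemma DERIV_log_bump: "(log_bump has_real_derivative log_bump' t) (at t)"
proof -
  have d: "(flat_exp 0 has_real_derivative flat_exp 2 t) (at t)" for t
    using DERIV_flat_exp[of 0 t] by (simp add: numeral_2_eq_2)
  have "((\<lambda>t. flat_exp 0 (3 - t)) has_real_derivative flat_exp 2 (3 - t) * (- 1)) (at t)"
    by (rule DERIV_chain2[OF d]) (auto intro!: derivative_eq_intros)
  from DERIV_mult[OF d this] show ?thesis
    unfolding log_bump_def[abs_def] log_bump'_def by (simp add: mult.commute)
qed

lemma log_bump_outside: "t \<notin> {0..3} \<Longrightarrow> log_bump t = 0" "t \<notin> {0..3} \<Longrightarrow> log_bump' t = 0"
  by (auto simp: log_bump_def log_bump'_def flat_exp_def)

lemma log_bump_bounds: "0 \<le> log_bump t" "log_bump t \<le> 1" "\<bar>log_bump' t\<bar> \<le> 2"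
proof -
  show "0 \<le> log_bump t" by (simp add: log_bump_def flat_exp_nonneg)
  show "log_bump t \<le> 1"
    using mult_mono[OF flat_exp_0_le_1[of t] flat_exp_0_le_1[of "3 - t"]]
    by (simp add: log_bump_def flat_exp_nonneg)
  have "0 \<le> flat_exp 2 s * flat_exp 0 t \<and> flat_exp 2 s * flat_exp 0 t \<le> 2" for s t
    using mult_mono[OF flat_exp_2_le_2[of s] flat_exp_0_le_1[of t]] by (simp add: flat_exp_nonneg)
  from this[of t "3 - t"] this[of "3 - t" t] show "\<bar>log_bump' t\<bar> \<le> 2"
    unfolding log_bump'_def by (simp add: mult.commute[of "flat_exp 0 t"] abs_le_iff)
qed

lemma log_bump_ge: "t \<in> {1..2} \<Longrightarrow> exp (- 2) \<le> log_bump t"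
  using mult_mono[OF flat_exp_0_ge[of t] flat_exp_0_ge[of "3 - t"]]
  by (simp add: log_bump_def flat_exp_nonneg flip: exp_add)

section \<open>Optimality of the constant\<close>

context punctured_hardy
begin

text \<open>Up to constants, \<open>W |x|\<^sup>-\<^sup>D\<close> is the scale-invariant density \<open>|x|\<^sup>-\<^sup>n\<close> near whichever of
  the ends \<open>0\<close>, \<open>\<infinity>\<close> has the smaller exponent; the shift \<open>s\<close> selects that end.\<close>

lemma weight_comparable:
  obtains \<kappa> K s where "\<kappa> > 0" "K > 0"
    "\<And>\<epsilon> x. \<epsilon> > 0 \<Longrightarrow> x \<noteq> 0 \<Longrightarrow> \<epsilon> * ln (norm x) + s \<in> {0..3} \<Longrightarrow>
      \<kappa> * inverse (norm x ^ CARD('n)) \<le> W x * norm x powr (- D) \<and>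
      W x * norm x powr (- D) \<le> K * inverse (norm x ^ CARD('n))"
proof (cases "\<delta> \<le> \<delta>'")
  case True
  show ?thesis
  \<comment> \<open>The shift \<open>3\<close> puts the support of the bump into
    \<open>norm x \<le> 1\<close> for every \<epsilon>; there \<open>1 + r\<close> lies between
    \<open>1\<close> and \<open>2\<close>, whence the two constants.\<close>
  proof (rule that[of 1 "2 powr (\<delta>' - \<delta>)" 3])
    fix \<epsilon> :: real and x :: "real^'n"
    assume e: "\<epsilon> > 0" and x: "x \<noteq> 0" and t: "\<epsilon> * ln (norm x) + 3 \<in> {0..3}"
    define r where "r = norm x"
    have r: "r > 0" using x by (simp add: r_def)
    have "\<epsilon> * ln r \<le> 0" using t by (simp add: r_def)
    then have "ln r \<le> 0" using e by (simp add: mult_le_0_iff)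
    then have r1: "r \<le> 1" using r by (simp add: ln_le_zero_iff)
    have "W x * r powr (- D) = (r powr (\<delta> - 2) * r powr (- D)) * (1 + r) powr (\<delta>' - \<delta>)"
      by (simp add: weight_eq degeneracy_coeff_def r_def)
    also have "r powr (\<delta> - 2) * r powr (- D) = inverse (r ^ CARD('n))"
      using True r by (simp add: dim_eq powr_add[symmetric] powr_minus powr_realpow[symmetric])
    finally have eq: "W x * r powr (- D) = inverse (r ^ CARD('n)) * (1 + r) powr (\<delta>' - \<delta>)" .
    have "1 \<le> (1 + r) powr (\<delta>' - \<delta>)" using True r by (intro ge_one_powr_ge_zero) auto
    moreover have "(1 + r) powr (\<delta>' - \<delta>) \<le> 2 powr (\<delta>' - \<delta>)"
      using True r r1 by (intro powr_mono2) auto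
    ultimately show "1 * inverse (norm x ^ CARD('n)) \<le> W x * norm x powr (- D) \<and>
      W x * norm x powr (- D) \<le> 2 powr (\<delta>' - \<delta>) * inverse (norm x ^ CARD('n))"
      using r unfolding r_def[symmetric] eq by simp
  qed auto
next
  case False
  show ?thesis
  \<comment> \<open>The shift \<open>0\<close> puts the support into \<open>norm x \<ge> 1\<close>.
    After factoring out the power at infinity, \<open>(1 + r) / r\<close> lies between
    \<open>1\<close> and \<open>2\<close>, now under a negative exponent.\<close>
  proof (rule that[of "2 powr (\<delta>' - \<delta>)" 1 0])
    fix \<epsilon> :: real and x :: "real^'n"
    assume e: "\<epsilon> > 0" and x: "x \<noteq> 0" and t: "\<epsilon> * ln (norm x) + 0 \<in> {0..3}"
    define r where "r = norm x"
    have r: "r > 0" using x by (simp add: r_def)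
    have "\<epsilon> * ln r \<ge> 0" using t by (simp add: r_def)
    then have "ln r \<ge> 0" using e by (simp add: zero_le_mult_iff)
    then have r1: "r \<ge> 1" using r by (simp add: ln_ge_zero_iff)
    have "W x * r powr (- D) = (r powr (\<delta> - 2) * r powr (- D)) * (1 + r) powr (\<delta>' - \<delta>)"
      by (simp add: weight_eq degeneracy_coeff_def r_def)
    also have "r powr (\<delta> - 2) * r powr (- D) = inverse (r ^ CARD('n)) * r powr (\<delta> - \<delta>')"
    proof -
      have "r powr (\<delta> - 2) * r powr (- D) = r powr (- real CARD('n) + (\<delta> - \<delta>'))"
        using False by (simp add: dim_eq powr_add[symmetric] algebra_simps)
      then show ?thesis
        using r by (simp only: powr_add powr_minus powr_realpow)
    qed
    also have "inverse (r ^ CARD('n)) * r powr (\<delta> - \<delta>') * (1 + r) powr (\<delta>' - \<delta>)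
      = inverse (r ^ CARD('n)) * ((1 + r) / r) powr (\<delta>' - \<delta>)"
      using r powr_minus_divide[of r "\<delta>' - \<delta>"] by (simp add: powr_divide)
    finally have eq: "W x * r powr (- D) = inverse (r ^ CARD('n)) * ((1 + r) / r) powr (\<delta>' - \<delta>)" .
    have q: "1 \<le> (1 + r) / r" "(1 + r) / r \<le> 2" using r r1 by (auto simp: field_simps)
    have "((1 + r) / r) powr (\<delta>' - \<delta>) \<le> ((1 + r) / r) powr 0"
      using False q by (intro powr_mono) auto
    then have "((1 + r) / r) powr (\<delta>' - \<delta>) \<le> 1" using r by simp
    moreover have "2 powr (\<delta>' - \<delta>) \<le> ((1 + r) / r) powr (\<delta>' - \<delta>)"
      using False q r by (intro powr_mono2') auto
    ultimately show "2 powr (\<delta>' - \<delta>) * inverse (norm x ^ CARD('n)) \<le> W x * norm x powr (- D) \<and>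
      W x * norm x powr (- D) \<le> 1 * inverse (norm x ^ CARD('n))"
      using r unfolding r_def[symmetric] eq by simp
  qed auto
qed

text \<open>The power with exponent \<open>- D / 2\<close> annihilates
  \<open>grad u + (D/2) u x/|x|\<^sup>2\<close>, the square discarded in the Hardy inequality; the
  bump truncates it so slowly that its derivative carries a factor \<epsilon>.\<close>

definition log_test :: "real \<Rightarrow> real \<Rightarrow> real^'n \<Rightarrow> real" where
  "log_test \<epsilon> s x = (if x = 0 then 0 else norm x powr (- D / 2) * log_bump (\<epsilon> * ln (norm x) + s))"

text \<open>Half the logarithm of the polynomial \<open>\<Sum>k. x $ k * x $ k\<close>, which is
  positive off the origin; derivatives of the norm are avoided.\<close>

lemma Ck_on_ln_norm: "Ck_on m \<Omega> (\<lambda>x. ln (norm x))"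
proof -
  have "Ck_on m \<Omega> (\<lambda>x. 1 / 2 * ln (\<Sum>k\<in>UNIV. x $ k * x $ k))"
    by (intro Ck_on_mult[OF open_punctured] Ck_on_const Ck_on_ln[OF open_punctured]
        Ck_on_sum[OF open_punctured] Ck_on_nth)
      (simp add: sum_nth_square power2_eq_square[symmetric] domain_eq)
  then show ?thesis
    by (rule Ck_on_cong[OF open_punctured, rotated])
      (simp add: sum_nth_square power2_eq_square[symmetric] domain_eq ln_realpow)
qed

lemma annulus_iff:
  assumes "\<epsilon> > 0" "x \<noteq> 0"
  shows "(exp ((a - s) / \<epsilon>) \<le> norm x \<and> norm x \<le> exp ((b - s) / \<epsilon>))
    \<longleftrightarrow> \<epsilon> * ln (norm x) + s \<in> {a..b}"
proof -
  have "exp ((a - s) / \<epsilon>) \<le> norm x \<longleftrightarrow> (a - s) / \<epsilon> \<le> ln (norm x)"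
    using assms(2) by (simp add: ln_ge_iff)
  also have "\<dots> \<longleftrightarrow> a \<le> \<epsilon> * ln (norm x) + s"
    using assms(1) by (simp add: pos_divide_le_eq mult.commute diff_le_eq)
  moreover have "norm x \<le> exp ((b - s) / \<epsilon>) \<longleftrightarrow> ln (norm x) \<le> (b - s) / \<epsilon>"
    using assms(2) exp_le_cancel_iff[of "ln (norm x)" "(b - s) / \<epsilon>"] by simp
  moreover have "\<dots> \<longleftrightarrow> \<epsilon> * ln (norm x) + s \<le> b"
    using assms(1) by (simp add: pos_le_divide_eq mult.commute le_diff_eq)
  ultimately show ?thesis by simp
qed

lemma log_test_in_test_functions:
  assumes e: "\<epsilon> > 0" shows "log_test \<epsilon> s \<in> test_functions \<Omega>"
  unfolding test_functions_iff
proof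
  fix m
  define K where "K = {x :: real^'n. exp (- s / \<epsilon>) \<le> norm x \<and> norm x \<le> exp ((3 - s) / \<epsilon>)}"
  have "bounded K" by (rule boundedI[of _ "exp ((3 - s) / \<epsilon>)"]) (simp add: K_def)
  moreover have "closed K"
    unfolding K_def by (intro closed_Collect_conj closed_Collect_le continuous_intros)
  ultimately have K: "compact K" by (simp add: compact_eq_bounded_closed)
  have sub: "K \<subseteq> \<Omega>" by (auto simp: K_def domain_eq)
  have out: "log_test \<epsilon> s x = 0" if "x \<notin> K" for x
  proof (cases "x = 0")
    case False
    have "x \<in> K \<longleftrightarrow> \<epsilon> * ln (norm x) + s \<in> {0..3}"
      using annulus_iff[OF e False, of 0 s 3] by (simp add: K_def)
    then have "\<epsilon> * ln (norm x) + s \<notin> {0..3}" using that by simp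
    then show ?thesis by (simp add: log_test_def log_bump_outside(1))
  qed (simp add: log_test_def)
  let ?T = "\<lambda>x. \<epsilon> * ln (norm x) + s"
  have T: "Ck_on m \<Omega> ?T"
    by (intro Ck_on_add[OF open_punctured] Ck_on_mult[OF open_punctured] Ck_on_const Ck_on_ln_norm)
  \<comment> \<open>The real power is written as an exponential of \<open>ln (norm x)\<close>, so
    that the closure properties of \<open>Ck_on\<close> apply.\<close>
  have "Ck_on m \<Omega> (\<lambda>x. exp (- D / 2 * ln (norm x)) * (flat_exp 0 (?T x) * flat_exp 0 (3 - ?T x)))"
    by (intro Ck_on_mult[OF open_punctured] Ck_on_exp[OF open_punctured] Ck_on_const Ck_on_ln_norm
        Ck_on_flat_exp[OF open_punctured] Ck_on_diff[OF open_punctured] T)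
  then have 1: "Ck_on m \<Omega> (log_test \<epsilon> s)"
    by (rule Ck_on_cong[OF open_punctured, rotated])
      (simp add: log_test_def log_bump_def powr_def domain_eq)
  have oK: "open (- K)" using K by (simp add: compact_imp_closed open_Compl)
  have 2: "Ck_on m (- K) (log_test \<epsilon> s)"
    by (rule Ck_on_cong[OF oK _ Ck_on_const[of _ _ 0]]) (simp add: out)
  have "\<Omega> \<union> - K = UNIV" using sub by auto
  with Ck_on_Un[OF open_punctured oK 1 2] show "Ck_compact m \<Omega> (log_test \<epsilon> s)"
    by (intro Ck_compactI[OF _ K sub out]) simp
qed

lemma partial_deriv_log_test:
  fixes \<epsilon> s :: real and x :: "real^'n"
  assumes x: "x \<in> \<Omega>"
  defines "\<tau> \<equiv> \<epsilon> * ln (norm x) + s"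
  shows "partial_deriv k (log_test \<epsilon> s) x = norm x powr (- D / 2) / norm x
    * (\<epsilon> * log_bump' \<tau> - D / 2 * log_bump \<tau>) * (x $ k / norm x)"
proof -
  define g where "g r = r powr (- D / 2) * log_bump (\<epsilon> * ln r + s)" for r
  have x0: "x \<noteq> 0" "norm x > 0" using x by (auto simp: domain_eq)
  have "partial_deriv k (log_test \<epsilon> s) x = partial_deriv k (\<lambda>x. g (norm x)) x"
    using x by (intro partial_deriv_cong_open[OF open_punctured]) (auto simp: log_test_def g_def domain_eq)
  moreover have "(g has_real_derivative norm x powr (- D / 2) / norm x
    * (\<epsilon> * log_bump' \<tau> - D / 2 * log_bump \<tau>)) (at (norm x))"
  proof -
    have d1: "((\<lambda>r. \<epsilon> * ln r + s) has_real_derivative \<epsilon> / norm x) (at (norm x))"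
      using x0 by (auto intro!: derivative_eq_intros)
    have d2: "((\<lambda>r. r powr (- D / 2)) has_real_derivative - D / 2 * norm x powr (- D / 2 - 1)) (at (norm x))"
      using x0 by (auto intro!: derivative_eq_intros)
    have p: "norm x powr (- D / 2 - 1) = norm x powr (- D / 2) / norm x"
      using x0 by (simp add: powr_diff)
    have "(g has_real_derivative - D / 2 * norm x powr (- D / 2 - 1) * log_bump \<tau>
      + log_bump' \<tau> * (\<epsilon> / norm x) * norm x powr (- D / 2)) (at (norm x))"
      unfolding g_def[abs_def] \<tau>_def
      by (rule DERIV_mult[OF d2 DERIV_chain2[OF DERIV_log_bump d1]])
    then show ?thesis unfolding p by (rule DERIV_cong) (simp add: algebra_simps)
  qed
  ultimately show ?thesis using partial_deriv_radial(2)[OF _ x0(1)] by simp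
qed

text \<open>The gradient is radial, so its squared components add up and the factor
  \<open>c / |x|\<^sup>2\<close> becomes \<open>W\<close>.\<close>

lemma energy_log_test:
  fixes \<epsilon> s :: real and x :: "real^'n"
  assumes x: "x \<in> \<Omega>"
  defines "\<tau> \<equiv> \<epsilon> * ln (norm x) + s"
  shows "(\<Sum>k\<in>UNIV. partial_deriv k (log_test \<epsilon> s) x * (c x * partial_deriv k (log_test \<epsilon> s) x))
    = W x * norm x powr (- D) * (\<epsilon> * log_bump' \<tau> - D / 2 * log_bump \<tau>)\<^sup>2"
proof -
  define A where "A = norm x powr (- D / 2)"
  define B where "B = \<epsilon> * log_bump' \<tau> - D / 2 * log_bump \<tau>"
  have x0: "norm x \<noteq> 0" using x by (auto simp: domain_eq)
  have A2: "norm x powr (- D) = A\<^sup>2"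
    by (simp add: A_def power2_eq_square powr_add[symmetric])
  have "partial_deriv k (log_test \<epsilon> s) x * (c x * partial_deriv k (log_test \<epsilon> s) x)
    = W x * A\<^sup>2 * B\<^sup>2 / (norm x)\<^sup>2 * (x $ k)\<^sup>2" for k
    unfolding partial_deriv_log_test[OF x] A_def[symmetric] \<tau>_def[symmetric] B_def[symmetric]
      coeff_over_square[symmetric]
    using x0 by (simp add: power2_eq_square divide_inverse mult_ac)
  then have "(\<Sum>k\<in>UNIV. partial_deriv k (log_test \<epsilon> s) x * (c x * partial_deriv k (log_test \<epsilon> s) x))
    = W x * A\<^sup>2 * B\<^sup>2 / (norm x)\<^sup>2 * (\<Sum>k\<in>UNIV. (x $ k)\<^sup>2)"
    by (simp only: sum_distrib_left)
  then show ?thesis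
    unfolding sum_nth_square A2 B_def[symmetric] using x0 by simp
qed

lemma log_test_square:
  assumes "x \<in> \<Omega>"
  shows "W x * (log_test \<epsilon> s x)\<^sup>2 = W x * norm x powr (- D) * (log_bump (\<epsilon> * ln (norm x) + s))\<^sup>2"
proof -
  have "norm x powr (- D) = (norm x powr (- D / 2))\<^sup>2"
    by (simp add: power2_eq_square powr_add[symmetric])
  then show ?thesis using assms by (simp add: log_test_def domain_eq power_mult_distrib)
qed

lemma integral_annulus_density:
  assumes "p > 0"
  shows "integrable (lebesgue_on \<Omega>) (annulus_density p q)"
    and "(\<integral>x. annulus_density p q x \<partial>lebesgue_on \<Omega>) = annulus_mass TYPE('n) p q"
proof -
  have z: "annulus_density p q x = 0" if "x \<notin> \<Omega>" for x :: "real^'n"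
    using that assms by (auto simp: domain_eq annulus_density_def)
  show "integrable (lebesgue_on \<Omega>) (annulus_density p q)"
    using integral_lebesgue_on_eq_lborel(2)[OF open_punctured annulus_density_measurable z]
      annulus_density_integrable[OF assms] by blast
  show "(\<integral>x. annulus_density p q x \<partial>lebesgue_on \<Omega>) = annulus_mass TYPE('n) p q"
    using integral_lebesgue_on_eq_lborel(1)[OF open_punctured annulus_density_measurable z]
    by (simp add: annulus_mass_def)
qed

lemma hardy_constant_le:
  assumes D: "D > 0" and hardy: "hardy_inequality \<Omega> c a"
  shows "a \<le> D\<^sup>2 / 4"
proof (rule ccontr)
  let ?M = "lebesgue_on \<Omega>"
  assume "\<not> a \<le> D\<^sup>2 / 4"
  then have a: "a - D\<^sup>2 / 4 > 0" by simp
  obtain \<kappa> K s where pos: "\<kappa> > 0" "K > 0" and cmp: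
    "\<And>\<epsilon> x. \<epsilon> > 0 \<Longrightarrow> x \<noteq> 0 \<Longrightarrow> \<epsilon> * ln (norm x) + s \<in> {0..3} \<Longrightarrow>
      \<kappa> * inverse (norm x ^ CARD('n)) \<le> W x * norm x powr (- D) \<and>
      W x * norm x powr (- D) \<le> K * inverse (norm x ^ CARD('n))"
    using weight_comparable by metis
  \<comment> \<open>From \<open>\<bar>log_bump * log_bump'\<bar> \<le> 2\<close>,
    \<open>log_bump'\<^sup>2 \<le> 4\<close> and \<open>\<epsilon>\<^sup>2 \<le> \<epsilon>\<close>
    in the error term below.\<close>
  define C where "C = K * (2 * D + 4)"
  define m where "m = \<kappa> * (exp (- 2))\<^sup>2"
  have Cm: "C > 0" "m > 0" using pos D by (auto simp: C_def m_def)
  \<comment> \<open>The left-hand side does not depend on \<epsilon>, so small \<epsilon>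
    contradicts \<open>a > D\<^sup>2 / 4\<close>.\<close>
  have key: "(a - D\<^sup>2 / 4) * m \<le> 3 * C * \<epsilon>" if e: "\<epsilon> > 0" "\<epsilon> \<le> 1" for \<epsilon>
  proof -
    define f where "f = log_test \<epsilon> s"
    define p where "p t = exp ((t - s) / \<epsilon>)" for t
    define E where "E x = (\<Sum>k\<in>UNIV. partial_deriv k f x * (c x * partial_deriv k f x))" for x
    have f: "f \<in> test_functions \<Omega>" unfolding f_def using e(1) by (rule log_test_in_test_functions)
    have p: "p t > 0" for t by (simp add: p_def)
    have iW: "integrable ?M (\<lambda>x. W x * (f x)\<^sup>2)" by (rule integrable_weight_test[OF f])
    have iE: "integrable ?M E"
      unfolding E_def by (intro Bochner_Integration.integrable_sum integrable_energy test_function_C1 f)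
    have E: "(\<integral>x. E x \<partial>?M) = pre_form \<Omega> c f"
      unfolding E_def pre_form_def L2_inner_def
      by (intro Bochner_Integration.integral_sum integrable_energy test_function_C1 f)
    have "a * (\<integral>x. W x * (f x)\<^sup>2 \<partial>?M) \<le> pre_form \<Omega> c f"
      using hardy test_function_in_h_dom[OF f]
      by (auto simp: hardy_inequality_def Let_def L2_inner_def hardy_function_square
          simp flip: power2_eq_square)
    then have "(a - D\<^sup>2 / 4) * (\<integral>x. W x * (f x)\<^sup>2 \<partial>?M) \<le> (\<integral>x. E x \<partial>?M) - D\<^sup>2 / 4 * (\<integral>x. W x * (f x)\<^sup>2 \<partial>?M)"
      unfolding E by (simp add: left_diff_distrib)
    also have "\<dots> = (\<integral>x. E x - D\<^sup>2 / 4 * (W x * (f x)\<^sup>2) \<partial>?M)"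
      using iE iW by simp
    also have "\<dots> \<le> (\<integral>x. C * \<epsilon> * annulus_density (p 0) (p 3) x \<partial>?M)"
    proof (rule integral_mono)
      show "integrable ?M (\<lambda>x. E x - D\<^sup>2 / 4 * (W x * (f x)\<^sup>2))" using iE iW by simp
      show "integrable ?M (\<lambda>x. C * \<epsilon> * annulus_density (p 0) (p 3) x)"
        by (intro integrable_mult_right integral_annulus_density p)
      fix x assume "x \<in> space ?M"
      then have x: "x \<in> \<Omega>" "x \<noteq> 0" by (auto simp: domain_eq)
      define \<tau> where "\<tau> = \<epsilon> * ln (norm x) + s"
      define P where "P = W x * norm x powr (- D)"
      \<comment> \<open>What remains of the squared derivative once \<open>D\<^sup>2 / 4\<close>
        times \<open>log_bump\<^sup>2\<close> cancels against the Hardy term; every surviving term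
        has a factor \<epsilon>.\<close>
      define Q where "Q = \<epsilon>\<^sup>2 * (log_bump' \<tau>)\<^sup>2 - D * \<epsilon> * (log_bump \<tau> * log_bump' \<tau>)"
      have P0: "P \<ge> 0" unfolding P_def using weight_nonneg by simp
      have eq: "E x - D\<^sup>2 / 4 * (W x * (f x)\<^sup>2) = P * Q"
        unfolding E_def f_def energy_log_test[OF x(1)] log_test_square[OF x(1)] P_def Q_def \<tau>_def[symmetric]
        by (simp add: power2_eq_square algebra_simps)
      show "E x - D\<^sup>2 / 4 * (W x * (f x)\<^sup>2) \<le> C * \<epsilon> * annulus_density (p 0) (p 3) x"
      proof (cases "\<tau> \<in> {0..3}")
        case False
        then have "Q = 0" by (simp add: Q_def log_bump_outside)
        then show ?thesis unfolding eq using Cm e by (simp add: annulus_density_nonneg)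
      next
        case True
        have "\<bar>log_bump \<tau> * log_bump' \<tau>\<bar> \<le> 1 * 2"
          unfolding abs_mult using log_bump_bounds[of \<tau>] by (intro mult_mono) auto
        then have "- (log_bump \<tau> * log_bump' \<tau>) \<le> 2" by simp
        then have "D * \<epsilon> * - (log_bump \<tau> * log_bump' \<tau>) \<le> D * \<epsilon> * 2"
          using D e by (intro mult_left_mono) auto
        moreover have "\<epsilon>\<^sup>2 * (log_bump' \<tau>)\<^sup>2 \<le> \<epsilon> * 4"
        proof (rule mult_mono)
          show "\<epsilon>\<^sup>2 \<le> \<epsilon>" using e by (simp add: power2_eq_square mult_left_le)
          show "(log_bump' \<tau>)\<^sup>2 \<le> 4" using power_mono[OF log_bump_bounds(3)[of \<tau>] abs_ge_zero, of 2] by simp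
        qed (use e in auto)
        ultimately have Q: "Q \<le> \<epsilon> * (2 * D + 4)" unfolding Q_def by (simp add: algebra_simps)
        have "P * Q \<le> P * (\<epsilon> * (2 * D + 4))" using Q P0 by (rule mult_left_mono)
        also have "\<dots> \<le> K * inverse (norm x ^ CARD('n)) * (\<epsilon> * (2 * D + 4))"
          using cmp[OF e(1) x(2)] True e D unfolding P_def \<tau>_def by (intro mult_right_mono) auto
        also have "\<dots> = C * \<epsilon> * annulus_density (p 0) (p 3) x"
          using True annulus_iff[OF e(1) x(2), of 0 s 3]
          by (simp add: annulus_density_def p_def C_def \<tau>_def)
        finally show ?thesis unfolding eq .
      qed
    qed
    also have "\<dots> = C * \<epsilon> * annulus_mass TYPE('n) (p 0) (p 3)"
      by (simp add: integral_annulus_density p)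
    finally have upper: "(a - D\<^sup>2 / 4) * (\<integral>x. W x * (f x)\<^sup>2 \<partial>?M) \<le> C * \<epsilon> * annulus_mass TYPE('n) (p 0) (p 3)" .
    have "m * annulus_mass TYPE('n) (p 1) (p 2) = (\<integral>x. m * annulus_density (p 1) (p 2) x \<partial>?M)"
      by (simp add: integral_annulus_density p)
    also have "\<dots> \<le> (\<integral>x. W x * (f x)\<^sup>2 \<partial>?M)"
    proof (rule integral_mono)
      show "integrable ?M (\<lambda>x. m * annulus_density (p 1) (p 2) x)"
        by (intro integrable_mult_right integral_annulus_density p)
      fix x assume "x \<in> space ?M"
      then have x: "x \<in> \<Omega>" "x \<noteq> 0" by (auto simp: domain_eq)
      define \<tau> where "\<tau> = \<epsilon> * ln (norm x) + s"
      show "m * annulus_density (p 1) (p 2) x \<le> W x * (f x)\<^sup>2"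
      proof (cases "\<tau> \<in> {1..2}")
        case True
        have "m * annulus_density (p 1) (p 2) x = \<kappa> * inverse (norm x ^ CARD('n)) * (exp (- 2))\<^sup>2"
          using True annulus_iff[OF e(1) x(2), of 1 s 2]
          by (simp add: annulus_density_def p_def m_def \<tau>_def)
        also have "\<dots> \<le> W x * norm x powr (- D) * (log_bump \<tau>)\<^sup>2"
        proof (rule mult_mono)
          show "\<kappa> * inverse (norm x ^ CARD('n)) \<le> W x * norm x powr (- D)"
            using cmp[OF e(1) x(2)] True unfolding \<tau>_def by simp
          show "(exp (- 2))\<^sup>2 \<le> (log_bump \<tau>)\<^sup>2"
            using log_bump_ge[OF True] by (intro power_mono) auto
        qed (auto simp: weight_nonneg)
        also have "\<dots> = W x * (f x)\<^sup>2"
          unfolding f_def log_test_square[OF x(1)] \<tau>_def ..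
        finally show ?thesis .
      next
        case False
        then have "annulus_density (p 1) (p 2) x = 0"
          using annulus_iff[OF e(1) x(2), of 1 s 2] by (simp add: annulus_density_def p_def \<tau>_def)
        then show ?thesis using weight_nonneg by simp
      qed
    qed (rule iW)
    finally have "(a - D\<^sup>2 / 4) * (m * annulus_mass TYPE('n) (p 1) (p 2)) \<le> C * \<epsilon> * annulus_mass TYPE('n) (p 0) (p 3)"
      using a upper by (meson less_imp_le mult_left_mono order_trans)
    also have "\<dots> \<le> C * \<epsilon> * (3 * annulus_mass TYPE('n) (p 1) (p 2))"
    proof -
      \<comment> \<open>A unit step in the variable \<open>\<epsilon> * ln (norm x) + s\<close> is a
        dilation by this factor, so the masses on both sides are comparable uniformly in \<epsilon>
        and cancel.\<close>
      define r where "r = exp (1 / \<epsilon>)"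
      have r: "1 < r" using e by (simp add: r_def)
      have "p 1 = p 0 * r" "p 2 = p 0 * r ^ 2" "p 3 = p 0 * r ^ 3"
        by (simp_all add: p_def r_def exp_of_nat_mult[symmetric] exp_add[symmetric] diff_divide_distrib)
      then show ?thesis
        using annulus_mass_cube_le[OF p[of 0] r, where 'n = 'n] Cm e by (intro mult_left_mono) auto
    qed
    finally have "((a - D\<^sup>2 / 4) * m) * annulus_mass TYPE('n) (p 1) (p 2)
      \<le> (3 * C * \<epsilon>) * annulus_mass TYPE('n) (p 1) (p 2)" by (simp add: mult_ac)
    moreover have "annulus_mass TYPE('n) (p 1) (p 2) > 0"
      using e by (intro annulus_mass_pos p) (simp add: p_def divide_strict_right_mono)
    ultimately show ?thesis by simp
  qed
  define q where "q = (a - D\<^sup>2 / 4) * m"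
  have q: "q > 0" unfolding q_def using a Cm by simp
  \<comment> \<open>The \<open>6\<close> makes \<open>3 * C * \<epsilon>\<close> at most
    \<open>q / 2\<close>, against the lower bound \<open>q\<close>.\<close>
  define \<epsilon> where "\<epsilon> = min 1 (q / (6 * C))"
  have "\<epsilon> > 0" "\<epsilon> \<le> 1" using q Cm by (auto simp: \<epsilon>_def)
  then have "q \<le> 3 * C * \<epsilon>" using key unfolding q_def by blast
  also have "\<dots> \<le> 3 * C * (q / (6 * C))" using Cm by (intro mult_left_mono) (auto simp: \<epsilon>_def)
  also have "\<dots> = q / 2" using Cm by simp
  finally show False using q by simp
qed

end

theorem mainTheorem11:
  fixes \<Omega> :: "(real^'n::finite) set" and c\<^sub>\<Omega> :: "real^'n \<Rightarrow> real"
    and \<delta> \<delta>' a\<^sub>1 :: real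
  assumes "\<delta> \<ge> 0" and "\<delta>' \<ge> 0"
    and "\<Omega> = UNIV - {0}"
    and "\<And>x. c\<^sub>\<Omega> x = degeneracy_coeff \<delta> \<delta>' (norm x)"
    and "real CARD('n) + min \<delta> \<delta>' - 2 > 0"
    and "a\<^sub>1 = (real CARD('n) + min \<delta> \<delta>' - 2)\<^sup>2 / 4"
  shows "hardy_inequality \<Omega> c\<^sub>\<Omega> a\<^sub>1 \<and> (\<forall>a. hardy_inequality \<Omega> c\<^sub>\<Omega> a \<longrightarrow> a \<le> a\<^sub>1)"
proof -
  interpret punctured_hardy \<delta> \<delta>' \<Omega> c\<^sub>\<Omega> "\<lambda>x. degeneracy_coeff (\<delta> - 2) (\<delta>' - 2) (norm x)"
    "real CARD('n) + min \<delta> \<delta>' - 2"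
    using assms(3,4) by unfold_locales auto
  show ?thesis
    using hardy_inequality_punctured hardy_constant_le assms(5) unfolding assms(6) by blast
qed

end
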